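(* Let $\mathbf{f}\in (L^2(\Omega))^3$, let $\mathbf{u}\in\mathbf{V}$ be the exact solution of the Stokes equation corresponding to $\mathbf{f}$, i.e. $(\nabla\mathbf{u},\nabla\mathbf{v})=(\mathbf{f},\mathbf{v})$ for all $\mathbf{v}\in\mathbf{V}$, let $\mathbf{u}_h=P_h\mathbf{u}\in\mathbf{V}_h$ be its finite element approximation, and let $\mathbf{f}_h=\pi_h\mathbf{f}\in\mathbf{X}_h$. Let $\mathbf{p}_h\in\mathbf{RT}_h$ be an approximation to $\nabla\mathbf{u}$ satisfying $$\mathrm{div}\,\mathbf{p}_h+\nabla\phi_h+\mathbf{f}_h=0\quad\text{for some }\phi_h\in U_h .$$ Then $$\|\nabla(\mathbf{u}-\mathbf{u}_h)\|\le\|\mathbf{p}_h-\nabla\mathbf{u}_h\|+C_{0,h}\|\mathbf{f}-\mathbf{f}_h\| \quad\text{and}\quad \|\nabla\mathbf{u}-\mathbf{p}_h\|\le\|\mathbf{p}_h-\nabla\mathbf{u}_h\|+C_{0,h}\|\mathbf{f}-\mathbf{f}_h\| .$$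
   Context: $\Omega\subset\mathbb{R}^3$ is a bounded Lipschitz polyhedral domain and $\mathcal{T}^h$ is a regular tetrahedral subdivision of $\Omega$. $(\cdot,\cdot)$ and $\|\cdot\|$ denote the $L^2(\Omega)$ inner product and norm (componentwise for vector and tensor fields). $\mathbf{V}=\{\mathbf{v}\in (H_0^1(\Omega))^3 : \mathrm{div}\,\mathbf{v}=0\}$. $H(\mathrm{div};\Omega)=\{p\in (L^2(\Omega))^3 : \mathrm{div}\,p\in L^2(\Omega)\}$. For a tensor field $\mathbf{p}=(p_1,p_2,p_3)$ with $p_i\in H(\mathrm{div};\Omega)$, $\mathrm{div}\,\mathbf{p}:=(\mathrm{div}\,p_1,\mathrm{div}\,p_2,\mathrm{div}\,p_3)$; $\nabla\mathbf{u}=(\nabla u_1,\nabla u_2,\nabla u_3)$. Finite element spaces: $P^m(K)$ is the set of polynomials of degree up to $m$ on $K\in\mathcal{T}^h$. The degrees are integers $k\ge 3$ and $d=m=k-1$. - $X_h$: the space of (discontinuous) piecewise polynomials of degree up to $d$ on $\mathcal{T}^h$; $\mathbf{X}_h=(X_h)^3$. - $U_h$: the space of functions in $H^1(\Omega)$ that are piecewise polynomials of degree up to $k$ on $\mathcal{T}^h$; $U_{h,0}=\{u_h\in U_h : u_h=0\text{ on }\partial\Omega\}$; $\mathbf{U}_{h,0}=(U_{h,0})^3$. - $\mathbf{V}_h=\{\mathbf{v}_h\in\mathbf{U}_{h,0} : \mathrm{div}\,\mathbf{v}_h=0\}\subset\mathbf{V}$. - $RT_h=\{p_h\in H(\mathrm{div};\Omega)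 : p_h|_K=\mathbf{a}_K+b_K\mathbf{x},\ \mathbf{a}_K\in(P^m(K))^3,\ b_K\in P^m(K),\ \forall K\in\mathcal{T}^h\}$ (Raviart–Thomas space); $\mathbf{RT}_h=(RT_h)^3$. $P_h:\mathbf{V}\to\mathbf{V}_h$ is the projection defined by $(\nabla(\mathbf{v}-P_h\mathbf{v}),\nabla\mathbf{v}_h)=0$ for all $\mathbf{v}_h\in\mathbf{V}_h$; thus $\mathbf{u}_h=P_h\mathbf{u}$ is the solution of $(\nabla\mathbf{u}_h,\nabla\mathbf{v}_h)=(\mathbf{f},\mathbf{v}_h)$ for all $\mathbf{v}_h\in\mathbf{V}_h$. $\pi_h:(L^2(\Omega))^3\to\mathbf{X}_h$ is the $L^2$-orthogonal projection. $C_{0,h}$ is a constant such that $\|\mathbf{w}-\pi_h\mathbf{w}\|\le C_{0,h}\|\nabla\mathbf{w}\|$ for all $\mathbf{w}\in\mathbf{V}$. *)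

theory Defs
  imports "HOL-Analysis.Analysis"
begin

section \<open>Square-integrable fields\<close>

text \<open>Elements of function spaces are represented by functions; equality in
  \<open>L\<^sup>2\<close> is equality almost everywhere on \<open>\<Omega>\<close>. For the codomains
  \<^typ>\<open>real^3\<close> and \<^typ>\<open>real^3^3\<close> the inner product of the library is the sum over all
  components, so the definitions below are the componentwise ones.\<close>

definition L2 :: "(real^3) set \<Rightarrow> (real^3 \<Rightarrow> 'b::euclidean_space) set" where
  "L2 \<Omega> = {f. f \<in> borel_measurable (lebesgue_on \<Omega>) \<and>
                integrable (lebesgue_on \<Omega>) (\<lambda>x. (norm (f x))\<^sup>2)}"

definition l2_inner ::
    "(real^3) set \<Rightarrow> (real^3 \<Rightarrow> 'b::euclidean_space) \<Rightarrow> (real^3 \<Rightarrow> 'b) \<Rightarrow> real" where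
  "l2_inner \<Omega> f g = (LINT x|lebesgue_on \<Omega>. f x \<bullet> g x)"

definition l2_norm :: "(real^3) set \<Rightarrow> (real^3 \<Rightarrow> 'b::euclidean_space) \<Rightarrow> real" where
  "l2_norm \<Omega> f = sqrt (l2_inner \<Omega> f f)"


section \<open>Test functions and weak derivatives\<close>

text \<open>Infinite differentiability, read coinductively: the function is differentiable
  everywhere and all its directional derivatives are again infinitely differentiable.\<close>

coinductive smooth :: "(real^3 \<Rightarrow> real) \<Rightarrow> bool" where
  "\<lbrakk>\<And>x. f differentiable (at x); \<And>b. smooth (\<lambda>x. frechet_derivative f (at x) b)\<rbrakk>
   \<Longrightarrow> smooth f"

definition test_functions :: "(real^3) set \<Rightarrow> (real^3 \<Rightarrow> real) set" where
  "test_functions \<Omega> =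
     {\<phi>. smooth \<phi> \<and> compact (closure {x. \<phi> x \<noteq> 0}) \<and> closure {x. \<phi> x \<noteq> 0} \<subseteq> \<Omega>}"

definition classical_grad :: "(real^3 \<Rightarrow> real) \<Rightarrow> real^3 \<Rightarrow> real^3" where
  "classical_grad \<phi> x = (\<chi> i. frechet_derivative \<phi> (at x) (axis i 1))"

definition has_weak_grad :: "(real^3) set \<Rightarrow> (real^3 \<Rightarrow> real) \<Rightarrow> (real^3 \<Rightarrow> real^3) \<Rightarrow> bool" where
  "has_weak_grad \<Omega> u g \<longleftrightarrow>
     (\<forall>\<phi>\<in>test_functions \<Omega>.
        (LINT x|lebesgue_on \<Omega>. u x *\<^sub>R classical_grad \<phi> x) =
        - (LINT x|lebesgue_on \<Omega>. \<phi> x *\<^sub>R g x))"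

definition has_weak_div :: "(real^3) set \<Rightarrow> (real^3 \<Rightarrow> real^3) \<Rightarrow> (real^3 \<Rightarrow> real) \<Rightarrow> bool" where
  "has_weak_div \<Omega> p q \<longleftrightarrow>
     (\<forall>\<phi>\<in>test_functions \<Omega>.
        (LINT x|lebesgue_on \<Omega>. p x \<bullet> classical_grad \<phi> x) =
        - (LINT x|lebesgue_on \<Omega>. q x * \<phi> x))"

definition H1 :: "(real^3) set \<Rightarrow> (real^3 \<Rightarrow> real) set" where
  "H1 \<Omega> = {u \<in> L2 \<Omega>. \<exists>g\<in>L2 \<Omega>. has_weak_grad \<Omega> u g}"

definition Hdiv :: "(real^3) set \<Rightarrow> (real^3 \<Rightarrow> real^3) set" where
  "Hdiv \<Omega> = {p \<in> L2 \<Omega>. \<exists>q\<in>L2 \<Omega>. has_weak_div \<Omega> p q}"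

text \<open>Weak derivatives are unique only up to null sets; a representative is chosen.
  The operators are meaningful on \<^term>\<open>H1 \<Omega>\<close> and \<^term>\<open>Hdiv \<Omega>\<close> respectively.\<close>

definition wgrad :: "(real^3) set \<Rightarrow> (real^3 \<Rightarrow> real) \<Rightarrow> real^3 \<Rightarrow> real^3" where
  "wgrad \<Omega> u = (SOME g. g \<in> L2 \<Omega> \<and> has_weak_grad \<Omega> u g)"

definition wdiv :: "(real^3) set \<Rightarrow> (real^3 \<Rightarrow> real^3) \<Rightarrow> real^3 \<Rightarrow> real" where
  "wdiv \<Omega> p = (SOME q. q \<in> L2 \<Omega> \<and> has_weak_div \<Omega> p q)"

definition vec_grad :: "(real^3) set \<Rightarrow> (real^3 \<Rightarrow> real^3) \<Rightarrow> real^3 \<Rightarrow> real^3^3" where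
  "vec_grad \<Omega> u x = (\<chi> i. wgrad \<Omega> (\<lambda>y. u y $ i) x)"

definition row_div :: "(real^3) set \<Rightarrow> (real^3 \<Rightarrow> real^3^3) \<Rightarrow> real^3 \<Rightarrow> real^3" where
  "row_div \<Omega> p x = (\<chi> i. wdiv \<Omega> (\<lambda>y. p y $ i) x)"

definition h1_norm :: "(real^3) set \<Rightarrow> (real^3 \<Rightarrow> real) \<Rightarrow> real" where
  "h1_norm \<Omega> u = sqrt ((l2_norm \<Omega> u)\<^sup>2 + (l2_norm \<Omega> (wgrad \<Omega> u))\<^sup>2)"

text \<open>The closure of the test functions in \<^term>\<open>H1 \<Omega>\<close>.\<close>

definition H10 :: "(real^3) set \<Rightarrow> (real^3 \<Rightarrow> real) set" where
  "H10 \<Omega> = {u \<in> H1 \<Omega>. \<exists>\<phi>. (\<forall>n::nat. \<phi> n \<in> test_functions \<Omega>) \<and>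
                          (\<lambda>n. h1_norm \<Omega> (\<lambda>x. u x - \<phi> n x)) \<longlonglongrightarrow> 0}"

definition divfree_H10 :: "(real^3) set \<Rightarrow> (real^3 \<Rightarrow> real^3) set" where
  "divfree_H10 \<Omega> = {v. (\<forall>i. (\<lambda>x. v x $ i) \<in> H10 \<Omega>) \<and>
                       (AE x in lebesgue_on \<Omega>. wdiv \<Omega> v x = 0)}"


section \<open>Domain and mesh\<close>

text \<open>Near every boundary point, \<open>\<Omega>\<close> is the set of points strictly above the graph of a
  Lipschitz function \<open>\<gamma>\<close> over the plane orthogonal to some unit vector \<open>e\<close>.\<close>

definition lipschitz_boundary :: "(real^3) set \<Rightarrow> bool" where
  "lipschitz_boundary \<Omega> \<longleftrightarrow>
     (\<forall>x\<in>frontier \<Omega>. \<exists>e r L \<gamma>. norm e = 1 \<and> r > 0 \<and>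
        L-lipschitz_on {z. z \<bullet> e = 0} \<gamma> \<and>
        \<Omega> \<inter> ball x r = {y \<in> ball x r. \<gamma> (y - (y \<bullet> e) *\<^sub>R e) < y \<bullet> e})"

definition lipschitz_polyhedral_domain :: "(real^3) set \<Rightarrow> bool" where
  "lipschitz_polyhedral_domain \<Omega> \<longleftrightarrow>
     \<Omega> \<noteq> {} \<and> open \<Omega> \<and> connected \<Omega> \<and> bounded \<Omega> \<and> lipschitz_boundary \<Omega> \<and>
     (\<exists>\<P>. finite \<P> \<and> (\<forall>P\<in>\<P>. polytope P) \<and> closure \<Omega> = \<Union>\<P>)"

text \<open>The library's \<^const>\<open>triangulation\<close> requires that the intersection of two cells is a
  (possibly empty) face of both.\<close>

definition tetrahedral_mesh :: "(real^3) set \<Rightarrow> (real^3) set set \<Rightarrow> bool" where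
  "tetrahedral_mesh \<Omega> \<T> \<longleftrightarrow>
     triangulation \<T> \<and> (\<forall>K\<in>\<T>. 3 simplex K) \<and> \<Union>\<T> = closure \<Omega>"


section \<open>Finite element spaces\<close>

definition polys :: "nat \<Rightarrow> (real^3 \<Rightarrow> real) set" where
  "polys m = {p. \<exists>c. p = (\<lambda>x. \<Sum>\<alpha> | (\<Sum>i\<in>UNIV. \<alpha> i) \<le> m.
                              c \<alpha> * (\<Prod>i\<in>UNIV. (x $ i) ^ (\<alpha> i :: nat)))}"

definition X_h :: "(real^3) set set \<Rightarrow> nat \<Rightarrow> (real^3 \<Rightarrow> real) set" where
  "X_h \<T> d = {w. \<forall>K\<in>\<T>. \<exists>p\<in>polys d. AE x in lebesgue_on K. w x = p x}"

definition vec_X_h :: "(real^3) set set \<Rightarrow> nat \<Rightarrow> (real^3 \<Rightarrow> real^3) set" where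
  "vec_X_h \<T> d = {w. \<forall>i. (\<lambda>x. w x $ i) \<in> X_h \<T> d}"

definition U_h :: "(real^3) set \<Rightarrow> (real^3) set set \<Rightarrow> nat \<Rightarrow> (real^3 \<Rightarrow> real) set" where
  "U_h \<Omega> \<T> k = {u \<in> H1 \<Omega>. \<forall>K\<in>\<T>. \<exists>p\<in>polys k. AE x in lebesgue_on K. u x = p x}"

text \<open>For a function of class \<open>H\<^sup>1\<close>, which is defined only up to null sets, vanishing on the
  boundary is understood in the sense of traces, that is, as membership in \<^term>\<open>H10 \<Omega>\<close>.\<close>

definition U_h0 :: "(real^3) set \<Rightarrow> (real^3) set set \<Rightarrow> nat \<Rightarrow> (real^3 \<Rightarrow> real) set" where
  "U_h0 \<Omega> \<T> k = {u \<in> U_h \<Omega> \<T> k. u \<in> H10 \<Omega>}"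

definition V_h :: "(real^3) set \<Rightarrow> (real^3) set set \<Rightarrow> nat \<Rightarrow> (real^3 \<Rightarrow> real^3) set" where
  "V_h \<Omega> \<T> k = {v. (\<forall>i. (\<lambda>x. v x $ i) \<in> U_h0 \<Omega> \<T> k) \<and>
                   (AE x in lebesgue_on \<Omega>. wdiv \<Omega> v x = 0)}"

definition RT_h :: "(real^3) set \<Rightarrow> (real^3) set set \<Rightarrow> nat \<Rightarrow> (real^3 \<Rightarrow> real^3) set" where
  "RT_h \<Omega> \<T> m = {p \<in> Hdiv \<Omega>. \<forall>K\<in>\<T>. \<exists>a b. (\<forall>i. (\<lambda>x. a x $ i) \<in> polys m) \<and> b \<in> polys m \<and>
                    (AE x in lebesgue_on K. p x = a x + b x *\<^sub>R x)}"

definition tensor_RT_h ::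
    "(real^3) set \<Rightarrow> (real^3) set set \<Rightarrow> nat \<Rightarrow> (real^3 \<Rightarrow> real^3^3) set" where
  "tensor_RT_h \<Omega> \<T> m = {p. \<forall>i. (\<lambda>x. p x $ i) \<in> RT_h \<Omega> \<T> m}"


section \<open>Projections\<close>

text \<open>Both projections are determined only up to null sets, so they are stated as relations
  between a function and any representative of its projection.\<close>

definition is_P_h ::
    "(real^3) set \<Rightarrow> (real^3) set set \<Rightarrow> nat \<Rightarrow> (real^3 \<Rightarrow> real^3) \<Rightarrow> (real^3 \<Rightarrow> real^3) \<Rightarrow> bool" where
  "is_P_h \<Omega> \<T> k v w \<longleftrightarrow> w \<in> V_h \<Omega> \<T> k \<and>
     (\<forall>v\<^sub>h\<in>V_h \<Omega> \<T> k. l2_inner \<Omega> (vec_grad \<Omega> (\<lambda>x. v x - w x)) (vec_grad \<Omega> v\<^sub>h) = 0)"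

definition is_pi_h ::
    "(real^3) set \<Rightarrow> (real^3) set set \<Rightarrow> nat \<Rightarrow> (real^3 \<Rightarrow> real^3) \<Rightarrow> (real^3 \<Rightarrow> real^3) \<Rightarrow> bool" where
  "is_pi_h \<Omega> \<T> d g w \<longleftrightarrow> w \<in> vec_X_h \<T> d \<and>
     (\<forall>w\<^sub>h\<in>vec_X_h \<T> d. l2_inner \<Omega> (\<lambda>x. g x - w x) w\<^sub>h = 0)"

end

theory Submission
  imports Defs
begin

text \<open>Why the estimate holds. For every solenoidal \<open>v\<close> with vanishing boundary values, Green's formula
  and the equilibrium condition \<open>div p\<^sub>h + \<nabla>\<phi>\<^sub>h + f\<^sub>h = 0\<close> turn the Stokes equation into
  \<open>(\<nabla>u - p\<^sub>h, \<nabla>v) = (f, v) + (div p\<^sub>h, v) = (f - f\<^sub>h, v)\<close>: the discrete pressure disappears because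
  gradients are orthogonal to solenoidal fields (\<open>equilibrated_residual\<close>). Since \<open>f - f\<^sub>h\<close> is
  orthogonal to piecewise polynomials, \<open>v\<close> may be replaced by \<open>v - \<pi>\<^sub>h v\<close>, so the right-hand side is
  at most \<open>E \<parallel>\<nabla>v\<parallel>\<close> with \<open>E = C\<^sub>0\<^sub>h \<parallel>f - f\<^sub>h\<parallel>\<close>. Take \<open>v = u - u\<^sub>h\<close> and put \<open>a = \<nabla>u - p\<^sub>h\<close>,
  \<open>b = p\<^sub>h - \<nabla>u\<^sub>h\<close>, so that \<open>\<nabla>v = a + b\<close> and \<open>(a, a + b) \<le> E \<parallel>a + b\<parallel>\<close>. If \<open>E\<close> were 0, the
  triangle with vertices \<open>\<nabla>u\<^sub>h\<close>, \<open>\<nabla>u\<close>, \<open>p\<^sub>h\<close> would have a right or obtuse angle at \<open>\<nabla>u\<close>, so that the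
  opposite side \<open>b\<close> would be the longest one, which is both claims at once; in general the bounds
  are off by at most \<open>E\<close> (\<open>hypercircle_bounds\<close>).

  Four facts carry the analysis. First, weak derivatives are unique almost everywhere, by the
  fundamental lemma of the calculus of variations (\<open>fundamental_lemma\<close>); without it not even the
  linearity of the chosen representatives is available. It rests on explicit bump
  functions built from \<open>exp (- 1 / t)\<close>. Second, smooth functions with compact support have their
  classical gradient as weak gradient (\<open>test_integration_by_parts\<close>), which is the translation
  invariance of the integral, differentiated. Together these give Green's formulas on the closure of
  the test functions. Third, the projection \<open>\<pi>\<^sub>h v\<close> exists (\<open>pi_h_exists\<close>), because up to null sets
  the piecewise polynomials are the span of finitely many monomials restricted to single cells.
  Fourth, \<open>C\<^sub>0\<^sub>h\<close> is nonnegative: this needs a solenoidal field whose gradient is not zero, and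
  one is constructed in every nonempty open set (\<open>divfree_field_nonzero_gradient\<close>).\<close>

section \<open>Square-integrable fields on a domain of finite measure\<close>

locale finite_domain =
  fixes \<Omega> :: "(real^3) set"
  assumes lmeasurable: "\<Omega> \<in> lmeasurable"
begin

abbreviation M where "M \<equiv> lebesgue_on \<Omega>"

lemma L2_measurable: "f \<in> L2 \<Omega> \<Longrightarrow> f \<in> borel_measurable M"
  by (simp add: L2_def)

lemma L2_square_integrable: "f \<in> L2 \<Omega> \<Longrightarrow> integrable M (\<lambda>x. (norm (f x))\<^sup>2)"
  by (simp add: L2_def)

lemma inner_integrable:
  fixes f g :: "real^3 \<Rightarrow> 'b::euclidean_space"
  assumes "f \<in> L2 \<Omega>" "g \<in> L2 \<Omega>"
  shows "integrable M (\<lambda>x. f x \<bullet> g x)"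
proof (rule Bochner_Integration.integrable_bound)
  show "integrable M (\<lambda>x. (norm (f x))\<^sup>2 + (norm (g x))\<^sup>2)"
    using assms by (simp add: L2_square_integrable)
  show "(\<lambda>x. f x \<bullet> g x) \<in> borel_measurable M"
    using assms by (simp add: L2_measurable borel_measurable_inner)
  have "\<bar>f x \<bullet> g x\<bar> \<le> (norm (f x))\<^sup>2 + (norm (g x))\<^sup>2" for x
  proof -
    have "\<bar>f x \<bullet> g x\<bar> \<le> norm (f x) * norm (g x)" by (rule Cauchy_Schwarz_ineq2)
    also have "\<dots> \<le> (norm (f x))\<^sup>2 + (norm (g x))\<^sup>2"
      using sum_squares_bound[of "norm (f x)" "norm (g x)"]
        mult_nonneg_nonneg[OF norm_ge_zero[of "f x"] norm_ge_zero[of "g x"]] by linarith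
    finally show ?thesis .
  qed
  then show "AE x in M. norm (f x \<bullet> g x) \<le> norm ((norm (f x))\<^sup>2 + (norm (g x))\<^sup>2)"
    by simp
qed

lemma L2_scaleR: "f \<in> L2 \<Omega> \<Longrightarrow> (\<lambda>x. c *\<^sub>R f x) \<in> L2 \<Omega>"
  by (auto simp: L2_def power_mult_distrib intro!: borel_measurable_scaleR)

lemma L2_add:
  fixes f g :: "real^3 \<Rightarrow> 'b::euclidean_space"
  assumes "f \<in> L2 \<Omega>" "g \<in> L2 \<Omega>"
  shows "(\<lambda>x. f x + g x) \<in> L2 \<Omega>"
proof -
  have "(\<lambda>x. (norm (f x + g x))\<^sup>2) = (\<lambda>x. (norm (f x))\<^sup>2 + (norm (g x))\<^sup>2 + 2 * (f x \<bullet> g x))"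
    by (simp add: power2_norm_eq_inner inner_add inner_commute algebra_simps)
  moreover have "integrable M \<dots>"
    using assms inner_integrable L2_square_integrable by (intro Bochner_Integration.integrable_add) auto
  ultimately show ?thesis
    using assms by (simp add: L2_def borel_measurable_add)
qed

lemma L2_uminus: "f \<in> L2 \<Omega> \<Longrightarrow> (\<lambda>x. - f x) \<in> L2 \<Omega>"
  using L2_scaleR[of f "-1"] by simp

lemma L2_diff:
  "f \<in> L2 \<Omega> \<Longrightarrow> g \<in> L2 \<Omega> \<Longrightarrow> (\<lambda>x. f x - g x) \<in> L2 \<Omega>"
  using L2_add[OF _ L2_uminus, of f g] by simp

lemma L2_zero [simp]: "(\<lambda>x. 0) \<in> L2 \<Omega>"
  by (simp add: L2_def)

lemma L2_sum: "finite I \<Longrightarrow> (\<And>i. i \<in> I \<Longrightarrow> f i \<in> L2 \<Omega>) \<Longrightarrow> (\<lambda>x. \<Sum>i\<in>I. f i x) \<in> L2 \<Omega>"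
  by (induction I rule: finite_induct) (auto intro: L2_add)

lemma bounded_measurable_L2:
  fixes f :: "real^3 \<Rightarrow> 'b::euclidean_space"
  assumes "f \<in> borel_measurable M" "\<And>x. x \<in> \<Omega> \<Longrightarrow> norm (f x) \<le> B"
  shows "f \<in> L2 \<Omega>"
proof -
  interpret finite_measure M by (rule finite_measure_lebesgue_on[OF lmeasurable])
  have "integrable M (\<lambda>x. (norm (f x))\<^sup>2)"
  proof (rule integrable_const_bound[where B = "B\<^sup>2"])
    show "AE x in M. norm ((norm (f x))\<^sup>2) \<le> B\<^sup>2"
      using assms(2) by (intro AE_I2) (simp add: power_mono)
  qed (use assms(1) in measurable)
  with assms(1) show ?thesis by (simp add: L2_def)
qed

text \<open>Lebesgue measure is complete, so a function that agrees almost everywhere with a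
  measurable one is measurable itself.\<close>

lemma measurable_AE_cong:
  fixes f g :: "real^3 \<Rightarrow> 'b::euclidean_space"
  assumes "f \<in> borel_measurable M" "AE x in M. f x = g x"
  shows "g \<in> borel_measurable M"
proof -
  have \<Omega>: "\<Omega> \<inter> space lebesgue \<in> sets lebesgue" using lmeasurable by (simp add: fmeasurableD)
  have "AE x in lebesgue. indicator \<Omega> x *\<^sub>R f x = indicator \<Omega> x *\<^sub>R g x"
    using assms(2) by (subst (asm) AE_restrict_space_iff[OF \<Omega>]) (auto simp: indicator_def)
  moreover have "(\<lambda>x. indicator \<Omega> x *\<^sub>R f x) \<in> borel_measurable lebesgue"
    using assms(1) by (subst (asm) borel_measurable_restrict_space_iff[OF \<Omega>]) (simp add: mult.commute)
  ultimately have "(\<lambda>x. indicator \<Omega> x *\<^sub>R g x) \<in> borel_measurable lebesgue"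
    by (rule borel_measurable_AE[rotated])
  then show ?thesis
    by (subst borel_measurable_restrict_space_iff[OF \<Omega>]) (simp add: mult.commute)
qed

lemma L2_AE_cong:
  fixes f g :: "real^3 \<Rightarrow> 'b::euclidean_space"
  assumes "f \<in> L2 \<Omega>" "AE x in M. f x = g x"
  shows "g \<in> L2 \<Omega>"
proof -
  have g: "g \<in> borel_measurable M"
    using measurable_AE_cong[OF L2_measurable[OF assms(1)] assms(2)] .
  have "integrable M (\<lambda>x. (norm (g x))\<^sup>2)"
    by (rule integrable_cong_AE_imp[OF L2_square_integrable[OF assms(1)]])
      (use g assms(2) in \<open>auto\<close>)
  with g show ?thesis by (simp add: L2_def)
qed

lemma l2_inner_AE_cong:
  fixes f g f' g' :: "real^3 \<Rightarrow> 'b::euclidean_space"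
  assumes "f \<in> L2 \<Omega>" "g \<in> L2 \<Omega>" "AE x in M. f x = f' x" "AE x in M. g x = g' x"
  shows "l2_inner \<Omega> f g = l2_inner \<Omega> f' g'"
  unfolding l2_inner_def
proof (rule integral_cong_AE)
  show "AE x in M. f x \<bullet> g x = f' x \<bullet> g' x" using assms(3,4) by auto
qed (use assms L2_AE_cong L2_measurable in \<open>auto intro!: borel_measurable_inner\<close>)

lemma l2_norm_AE_cong:
  fixes f f' :: "real^3 \<Rightarrow> 'b::euclidean_space"
  assumes "f \<in> L2 \<Omega>" "AE x in M. f x = f' x"
  shows "l2_norm \<Omega> f = l2_norm \<Omega> f'"
  using l2_inner_AE_cong[OF assms(1,1) assms(2,2)] by (simp add: l2_norm_def)

lemma l2_inner_commute: "l2_inner \<Omega> f g = l2_inner \<Omega> g f"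
  by (simp add: l2_inner_def inner_commute)

lemma l2_inner_zero [simp]: "l2_inner \<Omega> (\<lambda>x. 0) g = 0" "l2_inner \<Omega> f (\<lambda>x. 0) = 0"
  by (simp_all add: l2_inner_def)

lemma l2_inner_add_left:
  assumes "f \<in> L2 \<Omega>" "g \<in> L2 \<Omega>" "h \<in> L2 \<Omega>"
  shows "l2_inner \<Omega> (\<lambda>x. f x + g x) h = l2_inner \<Omega> f h + l2_inner \<Omega> g h"
  using assms by (simp add: l2_inner_def inner_add_left inner_integrable)

lemma l2_inner_diff_left:
  assumes "f \<in> L2 \<Omega>" "g \<in> L2 \<Omega>" "h \<in> L2 \<Omega>"
  shows "l2_inner \<Omega> (\<lambda>x. f x - g x) h = l2_inner \<Omega> f h - l2_inner \<Omega> g h"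
  using assms by (simp add: l2_inner_def inner_diff_left inner_integrable)

lemma l2_inner_add_right:
  assumes "f \<in> L2 \<Omega>" "g \<in> L2 \<Omega>" "h \<in> L2 \<Omega>"
  shows "l2_inner \<Omega> h (\<lambda>x. f x + g x) = l2_inner \<Omega> h f + l2_inner \<Omega> h g"
  using l2_inner_add_left[OF assms] by (simp add: l2_inner_commute)

lemma l2_inner_diff_right:
  assumes "f \<in> L2 \<Omega>" "g \<in> L2 \<Omega>" "h \<in> L2 \<Omega>"
  shows "l2_inner \<Omega> h (\<lambda>x. f x - g x) = l2_inner \<Omega> h f - l2_inner \<Omega> h g"
  using l2_inner_diff_left[OF assms] by (simp add: l2_inner_commute)

lemma l2_inner_scaleR_left:
  "l2_inner \<Omega> (\<lambda>x. c *\<^sub>R f x) h = c * l2_inner \<Omega> f h"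
  by (simp add: l2_inner_def)

lemma l2_inner_scaleR_right:
  "l2_inner \<Omega> f (\<lambda>x. c *\<^sub>R h x) = c * l2_inner \<Omega> f h"
  by (simp add: l2_inner_def)

lemma l2_inner_sum_left:
  assumes "finite I" "\<And>i. i \<in> I \<Longrightarrow> f i \<in> L2 \<Omega>" "h \<in> L2 \<Omega>"
  shows "l2_inner \<Omega> (\<lambda>x. \<Sum>i\<in>I. f i x) h = (\<Sum>i\<in>I. l2_inner \<Omega> (f i) h)"
  using assms by (induction I rule: finite_induct) (simp_all add: l2_inner_add_left L2_sum)

lemma l2_inner_nonneg: "l2_inner \<Omega> f f \<ge> 0"
  by (simp add: l2_inner_def)

lemma l2_norm_nonneg: "l2_norm \<Omega> f \<ge> 0"
  by (simp add: l2_norm_def l2_inner_nonneg)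

lemma l2_norm_squared: "(l2_norm \<Omega> f)\<^sup>2 = l2_inner \<Omega> f f"
  by (simp add: l2_norm_def l2_inner_nonneg)

lemma l2_inner_self_scaled_diff:
  assumes "f \<in> L2 \<Omega>" "g \<in> L2 \<Omega>"
  shows "l2_inner \<Omega> (\<lambda>x. f x - t *\<^sub>R g x) (\<lambda>x. f x - t *\<^sub>R g x)
    = l2_inner \<Omega> f f - 2 * t * l2_inner \<Omega> f g + t\<^sup>2 * l2_inner \<Omega> g g"
proof -
  have tg: "(\<lambda>x. t *\<^sub>R g x) \<in> L2 \<Omega>" using assms by (simp add: L2_scaleR)
  show ?thesis
    using assms tg
    by (simp add: l2_inner_diff_left l2_inner_diff_right L2_diff l2_inner_scaleR_left
      l2_inner_scaleR_right l2_inner_commute[of g f] power2_eq_square algebra_simps)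
qed

lemma l2_norm_diff_squared:
  assumes "f \<in> L2 \<Omega>" "g \<in> L2 \<Omega>"
  shows "(l2_norm \<Omega> (\<lambda>x. f x - g x))\<^sup>2
    = (l2_norm \<Omega> f)\<^sup>2 - 2 * l2_inner \<Omega> f g + (l2_norm \<Omega> g)\<^sup>2"
  using l2_inner_self_scaled_diff[OF assms, of 1] by (simp add: l2_norm_squared)

lemma l2_Cauchy_Schwarz:
  assumes "f \<in> L2 \<Omega>" "g \<in> L2 \<Omega>"
  shows "\<bar>l2_inner \<Omega> f g\<bar> \<le> l2_norm \<Omega> f * l2_norm \<Omega> g"
proof -
  let ?a = "l2_inner \<Omega> f f" and ?b = "l2_inner \<Omega> f g" and ?c = "l2_inner \<Omega> g g"
  have quad: "0 \<le> ?a - 2 * t * ?b + t\<^sup>2 * ?c" for t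
    using l2_inner_nonneg l2_inner_self_scaled_diff[OF assms, of t] by metis
  have "?b\<^sup>2 \<le> ?a * ?c"
  proof (cases "?c = 0")
    case True
    have "?b = 0"
    proof (rule ccontr)
      assume "?b \<noteq> 0"
      \<comment> \<open>The quadratic is linear in \<open>t\<close> here, and takes the value \<open>- 1\<close> at this point.\<close>
      with quad[of "(?a + 1) / (2 * ?b)"] True show False by (simp add: field_simps)
    qed
    with True show ?thesis by simp
  next
    case False
    then have c: "?c > 0" using l2_inner_nonneg[of g] by linarith
    have "?a - 2 * (?b / ?c) * ?b + (?b / ?c)\<^sup>2 * ?c = ?a - ?b\<^sup>2 / ?c"
      using c by (simp add: power2_eq_square field_simps)
    \<comment> \<open>The point \<open>?b / ?c\<close> minimizes the quadratic.\<close>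
    with quad[of "?b / ?c"] have "?b\<^sup>2 / ?c \<le> ?a" by simp
    with c show ?thesis by (simp add: field_simps)
  qed
  then have "sqrt (?b\<^sup>2) \<le> sqrt (?a * ?c)" by (rule real_sqrt_le_mono)
  then show ?thesis by (simp add: l2_norm_def real_sqrt_mult)
qed

lemma l2_norm_triangle_diff:
  assumes "f \<in> L2 \<Omega>" "g \<in> L2 \<Omega>"
  shows "l2_norm \<Omega> (\<lambda>x. f x - g x) \<le> l2_norm \<Omega> f + l2_norm \<Omega> g"
proof (rule power2_le_imp_le)
  show "(l2_norm \<Omega> (\<lambda>x. f x - g x))\<^sup>2 \<le> (l2_norm \<Omega> f + l2_norm \<Omega> g)\<^sup>2"
    using l2_Cauchy_Schwarz[OF assms] by (simp add: l2_norm_diff_squared[OF assms] power2_sum)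
qed (simp add: l2_norm_nonneg)

lemma l2_inner_tendsto:
  assumes "f \<in> L2 \<Omega>" "g \<in> L2 \<Omega>" "\<And>n. F n \<in> L2 \<Omega>"
    and "(\<lambda>n. l2_norm \<Omega> (\<lambda>x. f x - F n x)) \<longlonglongrightarrow> 0"
  shows "(\<lambda>n. l2_inner \<Omega> (F n) g) \<longlonglongrightarrow> l2_inner \<Omega> f g"
proof -
  have "(\<lambda>n. l2_inner \<Omega> f g - l2_inner \<Omega> (F n) g) \<longlonglongrightarrow> 0"
  proof (rule Lim_null_comparison)
    have "\<bar>l2_inner \<Omega> f g - l2_inner \<Omega> (F n) g\<bar> \<le> l2_norm \<Omega> (\<lambda>x. f x - F n x) * l2_norm \<Omega> g" for n
      using l2_Cauchy_Schwarz[OF L2_diff[OF assms(1) assms(3)] assms(2), of n]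
      by (simp add: l2_inner_diff_left[OF assms(1) assms(3) assms(2)])
    then show "\<forall>\<^sub>F n in sequentially. norm (l2_inner \<Omega> f g - l2_inner \<Omega> (F n) g)
        \<le> l2_norm \<Omega> (\<lambda>x. f x - F n x) * l2_norm \<Omega> g"
      by simp
    show "(\<lambda>n. l2_norm \<Omega> (\<lambda>x. f x - F n x) * l2_norm \<Omega> g) \<longlonglongrightarrow> 0"
      using tendsto_mult_right[OF assms(4), of "l2_norm \<Omega> g"] by simp
  qed
  from tendsto_diff[OF tendsto_const[of "l2_inner \<Omega> f g"] this] show ?thesis by simp
qed

lemma l2_norm_zero_AE:
  assumes "f \<in> L2 \<Omega>" "l2_norm \<Omega> f = 0"
  shows "AE x in M. f x = 0"
proof -
  have "integral\<^sup>L M (\<lambda>x. f x \<bullet> f x) = 0"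
    using assms(2) l2_norm_squared[of f] by (simp add: l2_inner_def)
  then have "AE x in M. f x \<bullet> f x = 0"
    by (subst (asm) integral_nonneg_eq_0_iff_AE) (simp_all add: inner_integrable assms(1))
  then show ?thesis by simp
qed

text \<open>Componentwise reduction, used both for vectors and for tensors (vectors of rows).\<close>

lemma L2_componentwise:
  fixes f :: "real^3 \<Rightarrow> 'b::euclidean_space^'n"
  shows "f \<in> L2 \<Omega> \<longleftrightarrow> (\<forall>i. (\<lambda>x. f x $ i) \<in> L2 \<Omega>)"
proof
  assume f: "f \<in> L2 \<Omega>"
  show "\<forall>i. (\<lambda>x. f x $ i) \<in> L2 \<Omega>"
  proof
    fix i
    have m: "(\<lambda>x. f x $ i) \<in> borel_measurable M"
      by (rule borel_measurable_continuous_on[OF _ L2_measurable[OF f]])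
        (intro continuous_intros)
    have "integrable M (\<lambda>x. (norm (f x $ i))\<^sup>2)"
    proof (rule Bochner_Integration.integrable_bound[OF L2_square_integrable[OF f]])
      show "AE x in M. norm ((norm (f x $ i))\<^sup>2) \<le> norm ((norm (f x))\<^sup>2)"
        by (simp add: power_mono Finite_Cartesian_Product.norm_nth_le)
    qed (use m in measurable)
    with m show "(\<lambda>x. f x $ i) \<in> L2 \<Omega>" by (simp add: L2_def)
  qed
next
  assume f: "\<forall>i. (\<lambda>x. f x $ i) \<in> L2 \<Omega>"
  have "(\<lambda>x. \<Sum>i\<in>UNIV. axis i (f x $ i)) \<in> L2 \<Omega>"
  proof (rule L2_sum)
    fix i :: 'n
    have fi: "(\<lambda>x. f x $ i) \<in> L2 \<Omega>" using f by blast
    have norm_axis: "norm (axis i y :: 'b^'n) = norm y" for y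
      by (simp add: norm_eq_sqrt_inner inner_axis)
    have "continuous_on UNIV (\<lambda>y::'b. axis i y :: 'b^'n)"
      unfolding axis_def
    proof (rule continuous_on_vec_lambda)
      show "continuous_on UNIV (\<lambda>y::'b. if j = i then y else 0)" for j
        by (cases "j = i") simp_all
    qed
    then have "(\<lambda>x. axis i (f x $ i) :: 'b^'n) \<in> borel_measurable M"
      by (rule borel_measurable_continuous_on[OF _ L2_measurable[OF fi]])
    then show "(\<lambda>x. axis i (f x $ i) :: 'b^'n) \<in> L2 \<Omega>"
      using fi by (simp add: L2_def norm_axis)
  qed simp
  moreover have "(\<Sum>i\<in>UNIV. axis i (f x $ i)) = f x" for x
    by (simp add: vec_eq_iff axis_def if_distrib[of "\<lambda>v. v $ _"] sum.delta cong: if_cong)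
  ultimately show "f \<in> L2 \<Omega>" by simp
qed

lemma l2_inner_componentwise:
  fixes f g :: "real^3 \<Rightarrow> 'b::euclidean_space^'n"
  assumes "f \<in> L2 \<Omega>" "g \<in> L2 \<Omega>"
  shows "l2_inner \<Omega> f g = (\<Sum>i\<in>UNIV. l2_inner \<Omega> (\<lambda>x. f x $ i) (\<lambda>x. g x $ i))"
  using assms unfolding l2_inner_def inner_vec_def
  by (intro Bochner_Integration.integral_sum inner_integrable) (simp_all add: L2_componentwise)

end

section \<open>Smooth functions with compact support\<close>

text \<open>For the powers \<open>j\<close> the functions \<open>exp (- 1 / t) / t ^ j\<close>, extended by 0, form a family that is
  closed under differentiation up to linear combinations. All smooth functions needed below are
  built from it.\<close>

definition flat :: "nat \<Rightarrow> real \<Rightarrow> real" where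
  "flat j t = (if t \<le> 0 then 0 else exp (- (1 / t)) / t ^ j)"

text \<open>Substituting \<open>1 / h\<close> for the argument, this says that the exponential outgrows every power. It is
  the derivative at the origin, the only place where the two pieces of the definition meet.\<close>

lemma flat_over_argument_tendsto_0: "((\<lambda>h. flat j h / h) \<longlongrightarrow> 0) (at 0)"
proof (rule filterlim_split_at)
  have "\<forall>\<^sub>F h in at_left 0. 0 = flat j h / h"
    by (simp add: eventually_at_left_field flat_def) (metis less_le_not_le lt_ex)
  then show "((\<lambda>h. flat j h / h) \<longlongrightarrow> 0) (at_left 0)"
    by (rule Lim_transform_eventually[OF tendsto_const])
  have "((\<lambda>h. (inverse h) ^ Suc j / exp (inverse h)) \<longlongrightarrow> (0::real)) (at_right 0)"
    using filterlim_compose[OF tendsto_power_div_exp_0 filterlim_inverse_at_top_right] .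
  moreover have "\<forall>\<^sub>F h in at_right 0. (inverse h) ^ Suc j / exp (inverse h) = flat j h / h"
    unfolding eventually_at_right_field
    by (rule exI[of _ 1]) (auto simp: flat_def exp_minus field_simps)
  ultimately show "((\<lambda>h. flat j h / h) \<longlongrightarrow> 0) (at_right 0)"
    by (rule Lim_transform_eventually)
qed

lemma flat_has_real_derivative:
  "(flat j has_real_derivative flat (j + 2) t - j * flat (j + 1) t) (at t)"
proof -
  consider "t < 0" | "t = 0" | "t > 0" by linarith
  then show ?thesis
  proof cases
    case 1
    have "((\<lambda>t. 0) has_real_derivative 0) (at t)" by simp
    then have "(flat j has_real_derivative 0) (at t)"
      by (rule has_field_derivative_transform_within_open[where S = "{..<0}"])
        (use 1 in \<open>auto simp: flat_def\<close>)
    with 1 show ?thesis by (simp add: flat_def)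
  next
    case 2
    then show ?thesis
      using flat_over_argument_tendsto_0[of j] by (simp add: has_field_derivative_iff flat_def)
  next
    case 3
    have "((\<lambda>t. exp (- (1 / t)) / t ^ j) has_real_derivative
        (exp (- (1 / t)) * (1 / t\<^sup>2) * t ^ j - exp (- (1 / t)) * (j * t ^ (j - 1))) / (t ^ j * t ^ j)) (at t)"
      by (rule derivative_eq_intros refl | use 3 in \<open>simp add: power2_eq_square\<close>)+
    moreover have "(exp (- (1 / t)) * (1 / t\<^sup>2) * t ^ j - exp (- (1 / t)) * (j * t ^ (j - 1))) / (t ^ j * t ^ j)
        = exp (- (1 / t)) / t ^ (j + 2) - j * (exp (- (1 / t)) / t ^ (j + 1))"
      using 3 by (cases j) (simp_all add: field_simps power2_eq_square)
    ultimately have "(flat j has_real_derivative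
        exp (- (1 / t)) / t ^ (j + 2) - j * (exp (- (1 / t)) / t ^ (j + 1))) (at t)"
      by (auto intro!: has_field_derivative_transform_within_open[where S = "{0<..}"
        and f = "\<lambda>t. exp (- (1 / t)) / t ^ j"] simp: 3 flat_def)
    with 3 show ?thesis by (simp add: flat_def)
  qed
qed

text \<open>An algebra of functions on which smoothness can be proved once and for all: it contains the
  directional derivatives of its members, and so is contained in the coinductively defined set of
  smooth functions.\<close>

inductive flat_algebra :: "(real^3 \<Rightarrow> real) \<Rightarrow> bool" where
  const: "flat_algebra (\<lambda>x. c)"
| flat: "flat_algebra (\<lambda>x. flat j (e \<bullet> x + b))"
| add: "flat_algebra f \<Longrightarrow> flat_algebra g \<Longrightarrow> flat_algebra (\<lambda>x. f x + g x)"
| mult: "flat_algebra f \<Longrightarrow> flat_algebra g \<Longrightarrow> flat_algebra (\<lambda>x. f x * g x)"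

lemma flat_algebra_prod:
  "finite I \<Longrightarrow> (\<And>i. i \<in> I \<Longrightarrow> flat_algebra (f i)) \<Longrightarrow> flat_algebra (\<lambda>x. \<Prod>i\<in>I. f i x)"
  by (induction I rule: finite_induct) (simp_all add: flat_algebra.const flat_algebra.mult)

lemma flat_algebra_diff:
  assumes "flat_algebra f" "flat_algebra g"
  shows "flat_algebra (\<lambda>x. f x - g x)"
  using flat_algebra.add[OF assms(1) flat_algebra.mult[OF flat_algebra.const[of "-1"] assms(2)]]
  by simp

lemma flat_algebra_derivative:
  "flat_algebra f \<Longrightarrow>
    \<exists>D. (\<forall>x. (f has_derivative D x) (at x)) \<and> (\<forall>v. flat_algebra (\<lambda>x. D x v))"
proof (induction rule: flat_algebra.induct)
  case (const c)
  then show ?case by (intro exI[of _ "\<lambda>x v. 0"]) (simp add: flat_algebra.const)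
next
  case (flat j e b)
  let ?d = "\<lambda>t. flat (j + 2) t - j * flat (j + 1) t"
  show ?case
  proof (intro exI[of _ "\<lambda>x v. ?d (e \<bullet> x + b) * (e \<bullet> v)"] conjI allI)
    fix x :: "real^3"
    have "(flat j has_derivative (\<lambda>s. ?d (e \<bullet> x + b) * s)) (at (e \<bullet> x + b))"
      using flat_has_real_derivative by (simp add: has_field_derivative_def)
    moreover have "((\<lambda>x. e \<bullet> x + b) has_derivative (\<lambda>v. e \<bullet> v)) (at x)"
      by (auto intro!: derivative_eq_intros)
    ultimately show "((\<lambda>x. flat j (e \<bullet> x + b)) has_derivative
        (\<lambda>v. ?d (e \<bullet> x + b) * (e \<bullet> v))) (at x)"
      by (rule has_derivative_compose[rotated])
  next
    show "flat_algebra (\<lambda>x. ?d (e \<bullet> x + b) * (e \<bullet> v))" for v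
      by (intro flat_algebra.mult flat_algebra_diff flat_algebra.const flat_algebra.flat)
  qed
next
  case (add f g)
  then obtain D E where "\<And>x. (f has_derivative D x) (at x)" "\<And>v. flat_algebra (\<lambda>x. D x v)"
    "\<And>x. (g has_derivative E x) (at x)" "\<And>v. flat_algebra (\<lambda>x. E x v)" by metis
  then show ?case
    by (intro exI[of _ "\<lambda>x v. D x v + E x v"]) (simp add: has_derivative_add flat_algebra.add)
next
  case (mult f g)
  then obtain D E where "\<And>x. (f has_derivative D x) (at x)" "\<And>v. flat_algebra (\<lambda>x. D x v)"
    "\<And>x. (g has_derivative E x) (at x)" "\<And>v. flat_algebra (\<lambda>x. E x v)" by metis
  then show ?case using mult.hyps
    by (intro exI[of _ "\<lambda>x v. f x * E x v + D x v * g x"])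
      (simp add: has_derivative_mult flat_algebra.add flat_algebra.mult)
qed

lemma smooth_differentiable: "smooth f \<Longrightarrow> f differentiable (at x)"
  by (subst (asm) smooth.simps) simp

lemma smooth_derivative: "smooth f \<Longrightarrow> smooth (\<lambda>x. frechet_derivative f (at x) v)"
  by (subst (asm) smooth.simps) simp

lemma smooth_continuous: "smooth f \<Longrightarrow> continuous_on UNIV f"
  by (intro differentiable_imp_continuous_on) (simp add: differentiable_on_def smooth_differentiable)

lemma smooth_has_derivative: "smooth f \<Longrightarrow> (f has_derivative frechet_derivative f (at x)) (at x)"
  by (simp add: smooth_differentiable flip: frechet_derivative_works)

lemma flat_algebra_smooth:
  assumes "flat_algebra f" shows "smooth f"
  using assms
proof (coinduction arbitrary: f)
  case smooth
  then obtain D where D: "\<And>x. (f has_derivative D x) (at x)" "\<And>v. flat_algebra (\<lambda>x. D x v)"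
    using flat_algebra_derivative by blast
  then have "frechet_derivative f (at x) = D x" for x
    by (intro frechet_derivative_at[symmetric])
  with D show ?case
    by (auto simp: differentiable_def)
qed

lemma smooth_diff:
  assumes "smooth f" "smooth g" shows "smooth (\<lambda>x. f x - g x)"
  using assms
proof (coinduction arbitrary: f g)
  case smooth
  have "frechet_derivative (\<lambda>x. f x - g x) (at x)
      = (\<lambda>v. frechet_derivative f (at x) v - frechet_derivative g (at x) v)" for x
    using smooth
    by (intro frechet_derivative_at[symmetric] has_derivative_diff smooth_has_derivative)
  moreover have "(\<lambda>x. f x - g x) differentiable (at x)" for x
    using smooth by (simp add: smooth_differentiable)
  moreover have "\<exists>f' g'. (\<lambda>x. frechet_derivative f (at x) v - frechet_derivative g (at x) v)
      = (\<lambda>x. f' x - g' x) \<and> smooth f' \<and> smooth g'" for v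
    using smooth
    by (intro exI[of _ "\<lambda>x. frechet_derivative f (at x) v"]
        exI[of _ "\<lambda>x. frechet_derivative g (at x) v"]) (simp add: smooth_derivative)
  ultimately show ?case
    by (intro exI[of _ "\<lambda>x. f x - g x"]) simp
qed

lemma classical_grad_component: "classical_grad \<phi> x $ i = frechet_derivative \<phi> (at x) (axis i 1)"
  by (simp add: classical_grad_def)

lemma test_smooth: "\<phi> \<in> test_functions \<Omega> \<Longrightarrow> smooth \<phi>"
  by (simp add: test_functions_def)

lemma test_zero_outside: "\<phi> \<in> test_functions \<Omega> \<Longrightarrow> x \<notin> \<Omega> \<Longrightarrow> \<phi> x = 0"
  using closure_subset[of "{x. \<phi> x \<noteq> 0}"] by (auto simp: test_functions_def)

text \<open>Any compact set outside of which the function vanishes can take the place of the support.\<close>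

lemma test_functionI:
  assumes "smooth \<phi>" "compact K" "K \<subseteq> \<Omega>" "\<And>x. x \<notin> K \<Longrightarrow> \<phi> x = 0"
  shows "\<phi> \<in> test_functions \<Omega>"
proof -
  have "closure {x. \<phi> x \<noteq> 0} \<subseteq> K"
    using assms(2,4) by (intro closure_minimal) (auto simp: compact_imp_closed)
  moreover from this have "compact (closure {x. \<phi> x \<noteq> 0})"
    using assms(2) compact_Int_closed[of K "closure {x. \<phi> x \<noteq> 0}"] by (simp add: Int_absorb1)
  ultimately show ?thesis using assms by (auto simp: test_functions_def)
qed

lemma test_diff:
  assumes "\<phi> \<in> test_functions \<Omega>" "\<psi> \<in> test_functions \<Omega>"
  shows "(\<lambda>x. \<phi> x - \<psi> x) \<in> test_functions \<Omega>"
proof (rule test_functionI)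
  let ?K = "closure {x. \<phi> x \<noteq> 0} \<union> closure {x. \<psi> x \<noteq> 0}"
  show "compact ?K" "?K \<subseteq> \<Omega>" using assms by (auto simp: test_functions_def)
  show "smooth (\<lambda>x. \<phi> x - \<psi> x)" using assms by (simp add: smooth_diff test_smooth)
  show "\<phi> x - \<psi> x = 0" if "x \<notin> ?K" for x
    using that closure_subset[of "{x. \<phi> x \<noteq> 0}"] closure_subset[of "{x. \<psi> x \<noteq> 0}"]
    by (metis (mono_tags, lifting) UnCI diff_self mem_Collect_eq subsetD)
qed

lemma test_derivative:
  assumes "\<phi> \<in> test_functions \<Omega>"
  shows "(\<lambda>x. frechet_derivative \<phi> (at x) v) \<in> test_functions \<Omega>"
proof (rule test_functionI)
  let ?K = "closure {x. \<phi> x \<noteq> 0}"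
  show "compact ?K" "?K \<subseteq> \<Omega>" using assms by (auto simp: test_functions_def)
  show "smooth (\<lambda>x. frechet_derivative \<phi> (at x) v)"
    using assms by (simp add: smooth_derivative test_smooth)
  show "frechet_derivative \<phi> (at x) v = 0" if "x \<notin> ?K" for x
  proof -
    have "(\<phi> has_derivative (\<lambda>v. 0)) (at x)"
    proof (rule has_derivative_transform_within_open[OF has_derivative_const[of 0]])
      show "open (- ?K)" "x \<in> - ?K" using that by auto
      show "0 = \<phi> y" if "y \<in> - ?K" for y
        using that closure_subset[of "{x. \<phi> x \<noteq> 0}"] by auto
    qed
    from frechet_derivative_at[OF this, symmetric] show ?thesis by (rule fun_cong)
  qed
qed

lemma classical_grad_component_test:
  "\<phi> \<in> test_functions \<Omega> \<Longrightarrow> (\<lambda>x. classical_grad \<phi> x $ i) \<in> test_functions \<Omega>"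
  by (simp add: classical_grad_component test_derivative)

lemma classical_grad_diff:
  assumes "\<phi> \<in> test_functions \<Omega>" "\<psi> \<in> test_functions \<Omega>"
  shows "classical_grad (\<lambda>x. \<phi> x - \<psi> x) x = classical_grad \<phi> x - classical_grad \<psi> x"
proof -
  have "frechet_derivative (\<lambda>x. \<phi> x - \<psi> x) (at x)
      = (\<lambda>v. frechet_derivative \<phi> (at x) v - frechet_derivative \<psi> (at x) v)"
    using assms
    by (intro frechet_derivative_at[symmetric] has_derivative_diff smooth_has_derivative test_smooth)
  then show ?thesis by (simp add: classical_grad_def vec_eq_iff)
qed

text \<open>For positive steepness \<open>s\<close>, a smooth function that is positive exactly on the open box; as \<open>s\<close>
  grows, it increases to the indicator function of the box.\<close>

definition box_bump :: "real \<Rightarrow> real^3 \<Rightarrow> real^3 \<Rightarrow> real^3 \<Rightarrow> real" where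
  "box_bump s l r x = (\<Prod>i\<in>UNIV. flat 0 (s * (x $ i - l $ i)) * flat 0 (s * (r $ i - x $ i)))"

lemma flat_algebra_coordinate: "flat_algebra (\<lambda>x. flat j (s * (x $ i - c)))"
proof -
  have "(\<lambda>x. flat j (s * (x $ i - c))) = (\<lambda>x. flat j ((s *\<^sub>R axis i 1) \<bullet> x + (- s * c)))"
    by (simp add: inner_axis' algebra_simps)
  then show ?thesis by (metis flat_algebra.flat)
qed

lemma flat_algebra_coordinate': "flat_algebra (\<lambda>x. flat j (s * (c - x $ i)))"
proof -
  have "(\<lambda>x. flat j (s * (c - x $ i))) = (\<lambda>x. flat j (- s * (x $ i - c)))"
    by (simp add: right_diff_distrib)
  then show ?thesis using flat_algebra_coordinate[of j "- s" i c] by simp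
qed

lemma box_bump_smooth: "smooth (box_bump s l r)"
  unfolding box_bump_def[abs_def]
  by (rule flat_algebra_smooth, rule flat_algebra_prod, simp, rule flat_algebra.mult,
      rule flat_algebra_coordinate, rule flat_algebra_coordinate')

lemma box_bump_zero:
  assumes "s > 0" "x \<notin> box l r" shows "box_bump s l r x = 0"
proof -
  from assms(2) obtain i where "\<not> (l $ i < x $ i \<and> x $ i < r $ i)"
    by (auto simp: mem_box_cart)
  then have "s * (x $ i - l $ i) \<le> 0 \<or> s * (r $ i - x $ i) \<le> 0"
    using assms(1) by (auto simp: mult_le_0_iff not_less)
  then have "flat 0 (s * (x $ i - l $ i)) * flat 0 (s * (r $ i - x $ i)) = 0"
    by (auto simp: flat_def)
  then show ?thesis unfolding box_bump_def by (intro prod_zero) auto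
qed

lemma box_bump_test:
  assumes "s > 0" "cbox l r \<subseteq> \<Omega>" shows "box_bump s l r \<in> test_functions \<Omega>"
proof (rule test_functionI[OF box_bump_smooth compact_cbox assms(2)])
  show "box_bump s l r x = 0" if "x \<notin> cbox l r" for x
    using that box_bump_zero[OF assms(1)] box_subset_cbox by blast
qed

lemma flat_0_bounds: "0 \<le> flat 0 t" "flat 0 t \<le> 1"
  by (auto simp: flat_def)

lemma box_bump_bounds: "0 \<le> box_bump s l r x" "box_bump s l r x \<le> 1"
proof -
  have "0 \<le> flat 0 a * flat 0 b" "flat 0 a * flat 0 b \<le> 1" for a b
    using flat_0_bounds[of a] flat_0_bounds[of b] by (simp_all add: mult_le_one)
  then show "0 \<le> box_bump s l r x" "box_bump s l r x \<le> 1"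
    unfolding box_bump_def by (simp_all add: prod_nonneg prod_le_1)
qed

lemma box_bump_tendsto_indicator:
  "(\<lambda>n. box_bump (real (Suc n)) l r x) \<longlonglongrightarrow> indicator (box l r) x"
proof (cases "x \<in> box l r")
  case True
  have "(\<lambda>n. flat 0 (real (Suc n) * t)) \<longlonglongrightarrow> 1" if "t > 0" for t
  proof -
    have "(\<lambda>n. exp (- (inverse (real (Suc n)) * (1 / t)))) \<longlonglongrightarrow> exp (- (0 * (1 / t)))"
      by (intro tendsto_intros LIMSEQ_inverse_real_of_nat)
    moreover have "exp (- (inverse (real (Suc n)) * (1 / t))) = flat 0 (real (Suc n) * t)" for n
    proof -
      have "\<not> real (Suc n) * t \<le> 0" using that by (simp add: not_le)
      then show ?thesis by (simp add: flat_def field_simps)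
    qed
    ultimately show ?thesis by simp
  qed
  then have "(\<lambda>n. box_bump (real (Suc n)) l r x) \<longlonglongrightarrow> (\<Prod>i\<in>(UNIV::3 set). 1 * 1)"
    using True unfolding box_bump_def
    by (intro tendsto_prod tendsto_mult) (auto simp: mem_box_cart)
  with True show ?thesis by simp
next
  case False
  then show ?thesis by (simp add: box_bump_zero)
qed

section \<open>Integration by parts and the fundamental lemma of the calculus of variations\<close>

text \<open>Boxes form a generator of the Borel sets that is stable under intersection, so a vanishing
  integral over all boxes extends to all Borel sets by Dynkin's argument; the total integral, needed
  for complements, is the limit over growing boxes. A Borel representative is used because this
  argument does not see the null sets by which Lebesgue sets differ from Borel sets.\<close>

lemma integral_all_boxes_zero_imp_AE_zero:
  fixes g :: "'a::euclidean_space \<Rightarrow> real"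
  assumes g: "integrable lebesgue g"
    and boxes: "\<And>a b. (LINT x|lebesgue. indicator (box a b) x * g x) = 0"
  shows "AE x in lebesgue. g x = 0"
proof -
  obtain g' where g': "g' \<in> borel_measurable lborel" and eq: "AE x in lborel. g x = g' x"
    using completion_ex_borel_measurable_real[OF borel_measurable_integrable[OF g]] by blast
  have g'_leb: "g' \<in> borel_measurable lebesgue" using g' by (rule measurable_completion)
  have eq': "AE x in lebesgue. g x = g' x" using eq by (rule AE_completion)
  have ind: "(indicator (box a b) :: 'a \<Rightarrow> real) \<in> borel_measurable lebesgue" for a b
    by (rule borel_measurable_indicator) (rule fmeasurableD, rule lmeasurable_box)
  have "integrable lebesgue g'" by (rule integrable_cong_AE_imp[OF g g'_leb eq'])
  then have int: "integrable lborel g'" using g' by (simp add: integrable_completion)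
  have set_int: "set_integrable lborel A g'" if "A \<in> sets borel" for A
    using integrable_mult_indicator[of A lborel g'] int that by (simp add: set_integrable_def)
  have box: "(LINT x:box a b|lborel. g' x) = 0" for a b
  proof -
    have "(LINT x:box a b|lborel. g' x) = (LINT x|lebesgue. indicator (box a b) x * g' x)"
      unfolding set_lebesgue_integral_def
      using g' by (subst integral_completion) simp_all
    also have "\<dots> = (LINT x|lebesgue. indicator (box a b) x * g x)"
      by (rule integral_cong_AE)
        (use eq' g'_leb ind borel_measurable_integrable[OF g] in \<open>auto intro!: borel_measurable_times\<close>)
    finally show ?thesis by (simp add: boxes)
  qed
  have total: "(LINT x|lborel. g' x) = 0"
  proof (rule LIMSEQ_unique)
    let ?B = "\<lambda>n::nat. box (- (real n *\<^sub>R One)) (real n *\<^sub>R One) :: 'a set"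
    show "(\<lambda>n. LINT x|lborel. indicator (?B n) x * g' x) \<longlonglongrightarrow> (LINT x|lborel. g' x)"
    proof (rule integral_dominated_convergence[where w = "\<lambda>x. norm (g' x)"])
      have "(\<lambda>n. indicator (?B n) x * g' x) \<longlonglongrightarrow> g' x" for x
      proof (rule tendsto_eventually)
        obtain N :: nat where N: "norm x < real N" using reals_Archimedean2 by blast
        have "x \<in> ?B n" if "n \<ge> N" for n
          unfolding mem_box
        proof
          fix b :: 'a assume b: "b \<in> Basis"
          have "\<bar>x \<bullet> b\<bar> < real n" using Basis_le_norm[OF b, of x] N that by linarith
          with b show "(- (real n *\<^sub>R One)) \<bullet> b < x \<bullet> b \<and> x \<bullet> b < (real n *\<^sub>R One) \<bullet> b"
            by (simp add: abs_less_iff)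
        qed
        then show "\<forall>\<^sub>F n in sequentially. indicator (?B n) x * g' x = g' x"
          by (auto simp: eventually_sequentially intro!: exI[of _ N])
      qed
      then show "AE x in lborel. (\<lambda>n. indicator (?B n) x * g' x) \<longlonglongrightarrow> g' x" by simp
      show "AE x in lborel. norm (indicator (?B n) x * g' x) \<le> norm (g' x)" for n
        by (auto simp: indicator_def)
    qed (use g' int in \<open>auto intro!: borel_measurable_times\<close>)
    show "(\<lambda>n. LINT x|lborel. indicator (?B n) x * g' x) \<longlonglongrightarrow> 0"
      using box by (simp add: set_lebesgue_integral_def)
  qed
  have all: "(LINT x:A|lborel. g' x) = 0" if "A \<in> sets borel" for A
  proof -
    let ?E = "range (\<lambda>(a, b). box a b :: 'a set)"
    have "Int_stable ?E" by (auto simp: Int_stable_def box_Int_box)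
    moreover have "?E \<subseteq> Pow UNIV" by simp
    moreover have "A \<in> sigma_sets UNIV ?E" using that by (simp add: borel_eq_box)
    ultimately show ?thesis
    proof (induction rule: sigma_sets_induct_disjoint)
      case (basic A)
      then show ?case using box by auto
    next
      case empty
      then show ?case by (simp add: set_lebesgue_integral_def)
    next
      case (compl A)
      then have A: "A \<in> sets borel" by (simp add: borel_eq_box)
      have "(LINT x:A \<union> (UNIV - A)|lborel. g' x) = (LINT x:A|lborel. g' x) + (LINT x:UNIV - A|lborel. g' x)"
        using A by (intro set_integral_Un set_int) auto
      with compl total show ?case by (simp add: set_lebesgue_integral_def)
    next
      case (union F)
      then have F: "\<And>i. F i \<in> sets borel" by (auto simp: borel_eq_box)
      have "(LINT x:(\<Union>i. F i)|lborel. g' x) = (\<Sum>i. LINT x:F i|lborel. g' x)"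
        using F union.hyps(1)
        by (intro lebesgue_integral_countable_add set_int) (auto simp: disjoint_family_on_def)
      with union show ?case by simp
    qed
  qed
  have "AE x in lborel. g' x = 0"
    by (rule density_unique_real[OF int]) (use all in \<open>auto simp: set_lebesgue_integral_def\<close>)
  then have "AE x in lebesgue. g' x = 0" by (rule AE_completion)
  with eq' show ?thesis by auto
qed

lemma lborel_integral_translate:
  fixes f :: "'a::euclidean_space \<Rightarrow> real"
  assumes "f \<in> borel_measurable borel"
  shows "(LINT x|lborel. f (c + x)) = (LINT x|lborel. f x)"
proof -
  have "(LINT x|distr lborel borel ((+) c). f x) = (LINT x|lborel. f (c + x))"
    using assms by (intro integral_distr) auto
  then show ?thesis by (simp add: lborel_distr_plus)
qed

lemma lborel_integrable_translate:
  fixes f :: "'a::euclidean_space \<Rightarrow> real"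
  assumes "integrable lborel f"
  shows "integrable lborel (\<lambda>x. f (c + x))"
proof -
  have "integrable (distr lborel borel ((+) c)) f" using assms by (simp only: lborel_distr_plus)
  from integrable_distr[OF _ this] show ?thesis by simp
qed

text \<open>The difference quotients in direction \<open>e\<close> have integral 0 by translation invariance. By the
  mean value theorem they are dominated by a constant on a fixed ball, so the integral of
  their limit is 0 too.\<close>

lemma integral_directional_derivative_zero:
  fixes h :: "'a::euclidean_space \<Rightarrow> real"
  assumes deriv: "\<And>x. (h has_derivative D x) (at x)"
    and cont: "continuous_on UNIV (\<lambda>x. D x e)"
    and K: "compact K" "\<And>x. x \<notin> K \<Longrightarrow> h x = 0"
  shows "(LINT x|lborel. D x e) = 0"
proof -
  obtain R where R: "K \<subseteq> cball 0 R"
    using compact_imp_bounded[OF K(1)] by (auto simp: bounded_iff subset_iff)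
  have h_cont: "continuous_on UNIV h"
    using has_derivative_continuous[OF deriv] by (simp add: continuous_on_eq_continuous_at)
  have D_zero: "D x e = 0" if "x \<notin> K" for x
  proof -
    have "(h has_derivative (\<lambda>v. 0)) (at x)"
    proof (rule has_derivative_transform_within_open[OF has_derivative_const[of 0]])
      show "open (- K)" "x \<in> - K" using K(1) that by (auto simp: compact_imp_closed)
    qed (simp add: K(2))
    from has_derivative_unique[OF deriv this] show ?thesis by simp
  qed
  have "compact ((\<lambda>x. D x e) ` K)"
    by (rule compact_continuous_image[OF continuous_on_subset[OF cont subset_UNIV] K(1)])
  then have "bounded ((\<lambda>x. D x e) ` K)" by (rule compact_imp_bounded)
  then obtain B where B: "B > 0" "\<And>x. x \<in> K \<Longrightarrow> \<bar>D x e\<bar> \<le> B"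
    by (auto simp: bounded_pos)
  have B': "\<bar>D x e\<bar> \<le> B" for x
    using B D_zero by (cases "x \<in> K") auto
  have line: "((\<lambda>t. h (x + t *\<^sub>R e)) has_real_derivative D (x + t *\<^sub>R e) e) (at t)" for x t
  proof -
    have "((\<lambda>t. x + t *\<^sub>R e) has_derivative (\<lambda>s. s *\<^sub>R e)) (at t)"
      by (auto intro!: derivative_eq_intros)
    from has_derivative_compose[OF this deriv]
    have "((\<lambda>t. h (x + t *\<^sub>R e)) has_derivative (\<lambda>s. D (x + t *\<^sub>R e) (s *\<^sub>R e))) (at t)" .
    moreover have "D (x + t *\<^sub>R e) (s *\<^sub>R e) = D (x + t *\<^sub>R e) e * s" for s
      using linear_cmul[OF has_derivative_linear[OF deriv]] by simp
    ultimately show ?thesis by (simp add: has_field_derivative_def)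
  qed
  define \<delta> where "\<delta> n = inverse (real (Suc n))" for n
  have \<delta>: "0 < \<delta> n" "\<delta> n \<le> 1" for n by (auto simp: \<delta>_def field_simps)
  define q where "q n x = (h (x + \<delta> n *\<^sub>R e) - h x) / \<delta> n" for n x
  have h_int: "integrable lborel h"
  proof -
    have "(\<lambda>x. indicator K x *\<^sub>R h x) = h"
      using K(2) by (intro ext) (auto simp: indicator_def)
    then show ?thesis
      using borel_integrable_compact[OF K(1) continuous_on_subset[OF h_cont]] by simp
  qed
  have q_int: "(LINT x|lborel. q n x) = 0" for n
    using lborel_integrable_translate[OF h_int, of "\<delta> n *\<^sub>R e"]
      lborel_integral_translate[of h "\<delta> n *\<^sub>R e"] h_int
    by (simp add: q_def add.commute)
  have q_bound: "\<bar>q n x\<bar> \<le> B * indicator (cball 0 (R + norm e)) x" for n x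
  proof (cases "x \<in> cball 0 (R + norm e)")
    case True
    obtain t where "h (x + \<delta> n *\<^sub>R e) - h (x + 0 *\<^sub>R e) = (\<delta> n - 0) * D (x + t *\<^sub>R e) e"
      using MVT2[OF \<delta>(1) line] by blast
    then have "q n x = D (x + t *\<^sub>R e) e" using \<delta>(1)[of n] by (simp add: q_def)
    with B' True show ?thesis by simp
  next
    case False
    have "norm (\<delta> n *\<^sub>R e) \<le> norm e"
      using \<delta>[of n] by (simp add: mult_left_le_one_le)
    then have "norm x \<le> norm (x + \<delta> n *\<^sub>R e) + norm e"
      using norm_triangle_ineq4[of "x + \<delta> n *\<^sub>R e" "\<delta> n *\<^sub>R e"] by simp
    with False have "x + \<delta> n *\<^sub>R e \<notin> cball 0 R" "x \<notin> cball 0 R"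
      using norm_ge_zero[of e] by (auto simp del: norm_ge_zero)
    with R K(2) have "h (x + \<delta> n *\<^sub>R e) = 0" "h x = 0" by blast+
    with False show ?thesis by (simp add: q_def)
  qed
  have "(\<lambda>n. q n x) \<longlonglongrightarrow> D x e" for x
  proof -
    have "((\<lambda>t. (h (x + t *\<^sub>R e) - h x) / t) \<longlongrightarrow> D x e) (at 0)"
      using line[of x 0] by (simp add: has_field_derivative_iff)
    moreover have "filterlim \<delta> (at 0) sequentially"
      unfolding filterlim_at \<delta>_def
      using LIMSEQ_inverse_real_of_nat by auto
    ultimately show ?thesis unfolding q_def by (rule filterlim_compose)
  qed
  moreover have "q n \<in> borel_measurable borel" for n
  proof -
    have "continuous_on UNIV (\<lambda>x. h (x + \<delta> n *\<^sub>R e))"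
      by (rule continuous_on_compose2[OF h_cont]) (auto intro!: continuous_intros)
    then have "continuous_on UNIV (q n)"
      using h_cont \<delta>(1)[of n] unfolding q_def[abs_def] by (intro continuous_intros) auto
    then show ?thesis by (rule borel_measurable_continuous_onI)
  qed
  moreover have "integrable lborel (\<lambda>x. B * indicator (cball 0 (R + norm e)) x)"
    using emeasure_lborel_cball_finite[of 0 "R + norm e"]
    by (intro integrable_mult_right integrable_real_indicator) simp_all
  ultimately have "(\<lambda>n. LINT x|lborel. q n x) \<longlonglongrightarrow> (LINT x|lborel. D x e)"
    using q_bound cont h_cont
    by (intro integral_dominated_convergence[where w = "\<lambda>x. B * indicator (cball 0 (R + norm e)) x"])
      (simp_all add: borel_measurable_continuous_onI)
  then show ?thesis using q_int LIMSEQ_unique[OF _ tendsto_const] by simp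
qed

locale open_domain = finite_domain +
  assumes open_domain: "open \<Omega>"
begin

lemma domain_sets: "\<Omega> \<inter> space lebesgue \<in> sets lebesgue"
  using lmeasurable by (simp add: fmeasurableD)

lemma integral_over_domain:
  fixes f :: "real^3 \<Rightarrow> real"
  assumes "\<And>x. x \<notin> \<Omega> \<Longrightarrow> f x = 0" "f \<in> borel_measurable borel"
  shows "(LINT x|M. f x) = (LINT x|lborel. f x)"
proof -
  have "(LINT x|M. f x) = (LINT x|lebesgue. indicator \<Omega> x *\<^sub>R f x)"
    by (rule integral_restrict_space[OF domain_sets])
  also have "(\<lambda>x. indicator \<Omega> x *\<^sub>R f x) = f"
    using assms(1) by (intro ext) (auto simp: indicator_def)
  also have "(LINT x|lebesgue. f x) = (LINT x|lborel. f x)"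
    using assms(2) by (intro integral_completion) simp
  finally show ?thesis .
qed

lemma test_L2:
  assumes "\<phi> \<in> test_functions \<Omega>" shows "\<phi> \<in> L2 \<Omega>"
proof -
  let ?K = "closure {x. \<phi> x \<noteq> 0}"
  have cont: "continuous_on UNIV \<phi>" using assms by (simp add: smooth_continuous test_smooth)
  have "compact (\<phi> ` ?K)"
    using assms cont by (intro compact_continuous_image)
      (auto simp: test_functions_def intro: continuous_on_subset)
  then have "bounded (\<phi> ` ?K)" by (rule compact_imp_bounded)
  then obtain B where B: "B > 0" "\<And>x. x \<in> ?K \<Longrightarrow> norm (\<phi> x) \<le> B"
    by (auto simp: bounded_pos)
  show ?thesis
  proof (rule bounded_measurable_L2)
    have "\<phi> \<in> borel_measurable lebesgue"
      using cont by (intro measurable_completion) (simp add: borel_measurable_continuous_onI)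
    then show "\<phi> \<in> borel_measurable M" by (rule measurable_restrict_space1)
    show "norm (\<phi> x) \<le> B" for x
      using B closure_subset[of "{x. \<phi> x \<noteq> 0}"] by (cases "\<phi> x = 0") auto
  qed
qed

lemma classical_grad_L2: "\<phi> \<in> test_functions \<Omega> \<Longrightarrow> classical_grad \<phi> \<in> L2 \<Omega>"
  by (simp add: L2_componentwise test_L2 classical_grad_component_test)

text \<open>The integral of a partial derivative of the product \<open>\<phi> \<psi>\<close> vanishes.\<close>

lemma test_integration_by_parts:
  assumes "\<phi> \<in> test_functions \<Omega>" "\<psi> \<in> test_functions \<Omega>"
  shows "l2_inner \<Omega> \<phi> (\<lambda>x. classical_grad \<psi> x $ i) = - l2_inner \<Omega> \<psi> (\<lambda>x. classical_grad \<phi> x $ i)"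
proof -
  let ?e = "axis i 1 :: real^3"
  let ?D = "\<lambda>x v. \<phi> x * frechet_derivative \<psi> (at x) v + frechet_derivative \<phi> (at x) v * \<psi> x"
  note sm = assms[THEN test_smooth]
  have cont: "continuous_on UNIV (\<lambda>x. ?D x ?e)"
    using sm by (intro continuous_intros smooth_continuous smooth_derivative)
  have "(LINT x|lborel. ?D x ?e) = 0"
  proof (rule integral_directional_derivative_zero[where D = ?D and e = ?e
        and h = "\<lambda>x. \<phi> x * \<psi> x" and K = "closure {x. \<phi> x \<noteq> 0}"])
    show "continuous_on UNIV (\<lambda>x. ?D x ?e)" by (rule cont)
    show "((\<lambda>x. \<phi> x * \<psi> x) has_derivative ?D x) (at x)" for x
      using sm by (intro has_derivative_mult smooth_has_derivative)
    show "compact (closure {x. \<phi> x \<noteq> 0})" using assms(1) by (simp add: test_functions_def)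
    show "\<phi> x * \<psi> x = 0" if "x \<notin> closure {x. \<phi> x \<noteq> 0}" for x
      using that closure_subset[of "{x. \<phi> x \<noteq> 0}"] by auto
  qed
  then have "(LINT x|M. ?D x ?e) = 0"
    using cont test_zero_outside[OF assms(1)] test_zero_outside[OF assms(2)]
    by (subst integral_over_domain) (auto simp: borel_measurable_continuous_onI)
  moreover have "(LINT x|M. ?D x ?e)
      = l2_inner \<Omega> \<phi> (\<lambda>x. classical_grad \<psi> x $ i) + l2_inner \<Omega> (\<lambda>x. classical_grad \<phi> x $ i) \<psi>"
    using inner_integrable[OF test_L2[OF assms(1)] test_L2[OF classical_grad_component_test[OF assms(2)]], of i]
      inner_integrable[OF test_L2[OF classical_grad_component_test[OF assms(1)]] test_L2[OF assms(2)], of i]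
    by (simp add: l2_inner_def classical_grad_component)
  ultimately show ?thesis by (simp add: l2_inner_commute)
qed

text \<open>Testing with steeper and steeper bumps shows that \<open>q\<close> has integral 0 over every box whose closure
  lies in \<open>\<Omega>\<close>. Hence \<open>q\<close> vanishes almost everywhere on each closed box in \<open>\<Omega>\<close>, and countably many
  of these cover \<open>\<Omega>\<close>.\<close>

lemma fundamental_lemma:
  assumes q: "q \<in> L2 \<Omega>" and orth: "\<And>\<phi>. \<phi> \<in> test_functions \<Omega> \<Longrightarrow> l2_inner \<Omega> q \<phi> = 0"
  shows "AE x in M. q x = 0"
proof -
  have q_meas: "q \<in> borel_measurable M" using q by (rule L2_measurable)
  have "(\<lambda>x. 1::real) \<in> L2 \<Omega>" by (rule bounded_measurable_L2[of _ 1]) auto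
  from inner_integrable[OF q this] have q_int: "integrable M q" by simp
  have box_sets: "box a b \<in> sets lebesgue" for a b :: "real^3" by simp
  have ind_meas: "(indicator (box a b) :: real^3 \<Rightarrow> real) \<in> borel_measurable M" for a b
    by (rule measurable_restrict_space1, rule borel_measurable_indicator) (rule box_sets)
  have box: "(LINT x|M. indicator (box a b) x * q x) = 0" if "cbox a b \<subseteq> \<Omega>" for a b
  proof (rule LIMSEQ_unique)
    let ?\<phi> = "\<lambda>n. box_bump (real (Suc n)) a b"
    have test: "?\<phi> n \<in> test_functions \<Omega>" for n using that by (intro box_bump_test) auto
    show "(\<lambda>n. LINT x|M. ?\<phi> n x * q x) \<longlonglongrightarrow> (LINT x|M. indicator (box a b) x * q x)"
    proof (rule integral_dominated_convergence[where w = "\<lambda>x. norm (q x)"])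
      show "(\<lambda>x. ?\<phi> n x * q x) \<in> borel_measurable M" for n
        by (intro borel_measurable_times L2_measurable test_L2 test q)
      show "(\<lambda>x. indicator (box a b) x * q x) \<in> borel_measurable M"
        by (intro borel_measurable_times ind_meas q_meas)
      show "AE x in M. (\<lambda>n. ?\<phi> n x * q x) \<longlonglongrightarrow> indicator (box a b) x * q x"
        by (intro AE_I2 tendsto_mult box_bump_tendsto_indicator tendsto_const)
      show "AE x in M. norm (?\<phi> n x * q x) \<le> norm (q x)" for n
      proof (rule AE_I2)
        fix x
        have "\<bar>?\<phi> n x\<bar> \<le> 1" using box_bump_bounds[of "real (Suc n)" a b x] by linarith
        then show "norm (?\<phi> n x * q x) \<le> norm (q x)"
          by (simp add: abs_mult mult_left_le_one_le)
      qed
    qed (use q_int in simp)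
    have "(LINT x|M. ?\<phi> n x * q x) = 0" for n
      using orth[OF test[of n]] by (simp add: l2_inner_def mult.commute)
    then show "(\<lambda>n. LINT x|M. ?\<phi> n x * q x) \<longlonglongrightarrow> 0" by simp
  qed
  have vanishes: "AE x in lebesgue. x \<in> cbox c d \<longrightarrow> q x = 0" if cd: "cbox c d \<subseteq> \<Omega>" for c d
  proof -
    let ?g = "\<lambda>x. indicator (box c d) x * q x"
    have sub: "box c d \<subseteq> \<Omega>" using cd box_subset_cbox by blast
    have as_M: "(LINT x|lebesgue. indicator (box a b) x * ?g x) = (LINT x|M. indicator (box a b \<inter> box c d) x * q x)" for a b
      unfolding integral_restrict_space[OF domain_sets]
      by (rule Bochner_Integration.integral_cong) (use sub in \<open>auto simp: indicator_def\<close>)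
    have "integrable M ?g"
      using q_int by (rule Bochner_Integration.integrable_bound)
        (intro borel_measurable_times ind_meas q_meas, simp add: indicator_def)
    then have "integrable lebesgue (\<lambda>x. indicator \<Omega> x *\<^sub>R ?g x)"
      by (simp only: integrable_restrict_space[OF domain_sets])
    also have "(\<lambda>x. indicator \<Omega> x *\<^sub>R ?g x) = ?g"
      using sub by (intro ext) (auto simp: indicator_def)
    finally have "AE x in lebesgue. ?g x = 0"
    proof (rule integral_all_boxes_zero_imp_AE_zero)
      fix a b :: "real^3"
      obtain a' b' where ab: "box a b \<inter> box c d = box a' b'" using box_Int_box by blast
      have "(LINT x|M. indicator (box a' b') x * q x) = 0"
      proof (cases "box a' b' = {}")
        case False
        then have "cbox a' b' = closure (box a' b')" by simp
        also have "\<dots> \<subseteq> closure (box c d)" using ab by (intro closure_mono) blast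
        also have "\<dots> \<subseteq> cbox c d" by (rule closure_minimal[OF box_subset_cbox closed_cbox])
        finally show ?thesis using cd by (intro box) blast
      qed simp
      with as_M[of a b] ab show "(LINT x|lebesgue. indicator (box a b) x * ?g x) = 0" by simp
    qed
    moreover have "AE x in lebesgue. x \<notin> cbox c d - box c d"
      using negligible_frontier_interval[of c d] by (intro AE_not_in) (simp add: negligible_iff_null_sets)
    ultimately show ?thesis by eventually_elim (auto simp: indicator_def split: if_splits)
  qed
  obtain \<D> where \<D>: "countable \<D>" "\<D> \<subseteq> Pow \<Omega>" "\<And>X. X \<in> \<D> \<Longrightarrow> \<exists>a b. X = cbox a b" "\<Union>\<D> = \<Omega>"
    using open_countable_Union_open_cbox[OF open_domain] by metis
  have "AE x in lebesgue. \<forall>X\<in>\<D>. x \<in> X \<longrightarrow> q x = 0"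
  proof (subst AE_ball_countable[OF \<D>(1)], rule ballI)
    fix X assume "X \<in> \<D>"
    with \<D>(2,3) show "AE x in lebesgue. x \<in> X \<longrightarrow> q x = 0" using vanishes by blast
  qed
  then have "AE x in lebesgue. x \<in> \<Omega> \<longrightarrow> q x = 0"
    using \<D>(4) by (auto elim!: eventually_mono)
  then show ?thesis by (subst AE_restrict_space_iff[OF domain_sets]) simp
qed

end

section \<open>Sobolev spaces and Green's formulas\<close>

context open_domain
begin

text \<open>The bridge from the vector-valued integrals that define the weak gradient to scalar inner
  products.\<close>

lemma weak_integral_component:
  fixes u :: "real^3 \<Rightarrow> real" and g :: "real^3 \<Rightarrow> real^3"
  assumes "u \<in> L2 \<Omega>" "g \<in> L2 \<Omega>"
  shows "(LINT x|M. u x *\<^sub>R g x) $ i = l2_inner \<Omega> u (\<lambda>x. g x $ i)"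
proof -
  have "integrable M (\<lambda>x. u x *\<^sub>R g x)"
    using assms lmeasurable inner_integrable[of u "\<lambda>x. g x $ _"]
    by (subst integrable_iff_component) (simp_all add: fmeasurableD L2_componentwise)
  from integral_bounded_linear[OF bounded_linear_vec_nth this]
  show ?thesis by (simp add: l2_inner_def)
qed

lemma has_weak_grad_iff:
  assumes "u \<in> L2 \<Omega>" "g \<in> L2 \<Omega>"
  shows "has_weak_grad \<Omega> u g \<longleftrightarrow> (\<forall>\<phi>\<in>test_functions \<Omega>. \<forall>i.
    l2_inner \<Omega> u (\<lambda>x. classical_grad \<phi> x $ i) = - l2_inner \<Omega> \<phi> (\<lambda>x. g x $ i))"
  unfolding has_weak_grad_def vec_eq_iff
  using assms by (simp add: weak_integral_component classical_grad_L2 test_L2)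

lemma has_weak_div_iff:
  "has_weak_div \<Omega> p q \<longleftrightarrow>
    (\<forall>\<phi>\<in>test_functions \<Omega>. l2_inner \<Omega> p (classical_grad \<phi>) = - l2_inner \<Omega> q \<phi>)"
  by (simp add: has_weak_div_def l2_inner_def)

lemma AE_eqI_test:
  fixes f g :: "real^3 \<Rightarrow> real"
  assumes "f \<in> L2 \<Omega>" "g \<in> L2 \<Omega>"
    and "\<And>\<phi>. \<phi> \<in> test_functions \<Omega> \<Longrightarrow> l2_inner \<Omega> f \<phi> = l2_inner \<Omega> g \<phi>"
  shows "AE x in M. f x = g x"
proof -
  have "AE x in M. f x - g x = 0"
    using assms by (intro fundamental_lemma) (simp_all add: L2_diff l2_inner_diff_left test_L2)
  then show ?thesis by simp
qed

lemma AE_vec_eqI: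
  fixes f g :: "real^3 \<Rightarrow> 'b^'n"
  assumes "\<And>i. AE x in M. f x $ i = g x $ i"
  shows "AE x in M. f x = g x"
proof -
  have "AE x in M. \<forall>i\<in>UNIV. f x $ i = g x $ i"
    using assms by (intro AE_finite_allI) auto
  then show ?thesis by (simp add: vec_eq_iff)
qed

lemma weak_grad_unique:
  assumes "u \<in> L2 \<Omega>" "g \<in> L2 \<Omega>" "h \<in> L2 \<Omega>" "has_weak_grad \<Omega> u g" "has_weak_grad \<Omega> u h"
  shows "AE x in M. g x = h x"
proof (intro AE_vec_eqI AE_eqI_test)
  fix i and \<phi> assume \<phi>: "\<phi> \<in> test_functions \<Omega>"
  have "l2_inner \<Omega> \<phi> (\<lambda>x. g x $ i) = l2_inner \<Omega> \<phi> (\<lambda>x. h x $ i)"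
    using assms(4,5) \<phi> unfolding has_weak_grad_iff[OF assms(1,2)] has_weak_grad_iff[OF assms(1,3)]
    by (metis neg_equal_iff_equal)
  then show "l2_inner \<Omega> (\<lambda>x. g x $ i) \<phi> = l2_inner \<Omega> (\<lambda>x. h x $ i) \<phi>"
    by (simp add: l2_inner_commute)
qed (use assms in \<open>simp_all add: L2_componentwise\<close>)

lemma weak_div_unique:
  assumes "q \<in> L2 \<Omega>" "r \<in> L2 \<Omega>" "has_weak_div \<Omega> p q" "has_weak_div \<Omega> p r"
  shows "AE x in M. q x = r x"
  using assms(3,4) unfolding has_weak_div_iff
  by (intro AE_eqI_test assms(1,2)) (metis neg_equal_iff_equal)

lemma H1_L2: "u \<in> H1 \<Omega> \<Longrightarrow> u \<in> L2 \<Omega>"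
  by (simp add: H1_def)

lemma Hdiv_L2: "p \<in> Hdiv \<Omega> \<Longrightarrow> p \<in> L2 \<Omega>"
  by (simp add: Hdiv_def)

lemma wgrad_spec:
  assumes "u \<in> H1 \<Omega>" shows "wgrad \<Omega> u \<in> L2 \<Omega> \<and> has_weak_grad \<Omega> u (wgrad \<Omega> u)"
proof -
  have "\<exists>g. g \<in> L2 \<Omega> \<and> has_weak_grad \<Omega> u g" using assms by (auto simp: H1_def)
  then show ?thesis unfolding wgrad_def by (rule someI_ex)
qed

lemma wgrad_L2: "u \<in> H1 \<Omega> \<Longrightarrow> wgrad \<Omega> u \<in> L2 \<Omega>"
  using wgrad_spec by blast

lemma wgrad_component_L2: "u \<in> H1 \<Omega> \<Longrightarrow> (\<lambda>x. wgrad \<Omega> u x $ i) \<in> L2 \<Omega>"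
  using wgrad_L2 by (simp add: L2_componentwise)

lemma wgrad_test:
  assumes "u \<in> H1 \<Omega>" "\<phi> \<in> test_functions \<Omega>"
  shows "l2_inner \<Omega> u (\<lambda>x. classical_grad \<phi> x $ i) = - l2_inner \<Omega> \<phi> (\<lambda>x. wgrad \<Omega> u x $ i)"
  using wgrad_spec[OF assms(1)] assms(2) has_weak_grad_iff[OF H1_L2 wgrad_L2, OF assms(1,1)]
  by blast

lemma wdiv_spec:
  assumes "p \<in> Hdiv \<Omega>" shows "wdiv \<Omega> p \<in> L2 \<Omega> \<and> has_weak_div \<Omega> p (wdiv \<Omega> p)"
proof -
  have "\<exists>q. q \<in> L2 \<Omega> \<and> has_weak_div \<Omega> p q" using assms by (auto simp: Hdiv_def)
  then show ?thesis unfolding wdiv_def by (rule someI_ex)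
qed

lemma wdiv_L2: "p \<in> Hdiv \<Omega> \<Longrightarrow> wdiv \<Omega> p \<in> L2 \<Omega>"
  using wdiv_spec by blast

lemma wdiv_test:
  assumes "p \<in> Hdiv \<Omega>" "\<phi> \<in> test_functions \<Omega>"
  shows "l2_inner \<Omega> p (classical_grad \<phi>) = - l2_inner \<Omega> (wdiv \<Omega> p) \<phi>"
  using wdiv_spec[OF assms(1)] assms(2) by (simp add: has_weak_div_iff)

text \<open>How membership is established and the chosen gradient identified at the same time: any
  weak gradient that can be exhibited is the chosen one almost everywhere.\<close>

lemma H1I:
  assumes "u \<in> L2 \<Omega>" "g \<in> L2 \<Omega>"
    and "\<And>\<phi> i. \<phi> \<in> test_functions \<Omega> \<Longrightarrow>
      l2_inner \<Omega> u (\<lambda>x. classical_grad \<phi> x $ i) = - l2_inner \<Omega> \<phi> (\<lambda>x. g x $ i)"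
  shows "u \<in> H1 \<Omega>" "AE x in M. wgrad \<Omega> u x = g x"
proof -
  have wg: "has_weak_grad \<Omega> u g" using assms by (simp add: has_weak_grad_iff)
  with assms(1,2) show H1: "u \<in> H1 \<Omega>" by (auto simp: H1_def)
  show "AE x in M. wgrad \<Omega> u x = g x"
    using weak_grad_unique[OF assms(1) _ assms(2) _ wg] wgrad_spec[OF H1] by blast
qed

lemma HdivI:
  assumes "p \<in> L2 \<Omega>" "q \<in> L2 \<Omega>"
    and "\<And>\<phi>. \<phi> \<in> test_functions \<Omega> \<Longrightarrow> l2_inner \<Omega> p (classical_grad \<phi>) = - l2_inner \<Omega> q \<phi>"
  shows "p \<in> Hdiv \<Omega>" "AE x in M. wdiv \<Omega> p x = q x"
proof -
  have wd: "has_weak_div \<Omega> p q" using assms by (simp add: has_weak_div_iff)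
  with assms(1,2) show Hdiv: "p \<in> Hdiv \<Omega>" by (auto simp: Hdiv_def)
  show "AE x in M. wdiv \<Omega> p x = q x"
    using weak_div_unique[OF _ assms(2) _ wd] wdiv_spec[OF Hdiv] by blast
qed

lemma test_H1:
  assumes "\<phi> \<in> test_functions \<Omega>"
  shows "\<phi> \<in> H1 \<Omega>" "AE x in M. wgrad \<Omega> \<phi> x = classical_grad \<phi> x"
proof -
  note * = H1I[OF test_L2[OF assms] classical_grad_L2[OF assms]]
  show "\<phi> \<in> H1 \<Omega>" "AE x in M. wgrad \<Omega> \<phi> x = classical_grad \<phi> x"
    by (rule *, rule test_integration_by_parts[OF assms], assumption)+
qed

lemma H1_diff:
  assumes "u \<in> H1 \<Omega>" "v \<in> H1 \<Omega>"
  shows "(\<lambda>x. u x - v x) \<in> H1 \<Omega>"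
    and "AE x in M. wgrad \<Omega> (\<lambda>x. u x - v x) x = wgrad \<Omega> u x - wgrad \<Omega> v x"
proof -
  have L2s: "(\<lambda>x. u x - v x) \<in> L2 \<Omega>" "(\<lambda>x. wgrad \<Omega> u x - wgrad \<Omega> v x) \<in> L2 \<Omega>"
    using assms by (simp_all add: L2_diff H1_L2 wgrad_L2)
  have "l2_inner \<Omega> (\<lambda>x. u x - v x) (\<lambda>x. classical_grad \<phi> x $ i)
      = - l2_inner \<Omega> \<phi> (\<lambda>x. (wgrad \<Omega> u x - wgrad \<Omega> v x) $ i)"
    if "\<phi> \<in> test_functions \<Omega>" for \<phi> i
    using assms that
    by (simp add: l2_inner_diff_left l2_inner_diff_right H1_L2 wgrad_component_L2 test_L2
        classical_grad_component_test wgrad_test)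
  from H1I[OF L2s this]
  show "(\<lambda>x. u x - v x) \<in> H1 \<Omega>"
    "AE x in M. wgrad \<Omega> (\<lambda>x. u x - v x) x = wgrad \<Omega> u x - wgrad \<Omega> v x" by blast+
qed

lemma h1_norm_test_diff:
  assumes "u \<in> H1 \<Omega>" "\<phi> \<in> test_functions \<Omega>"
  shows "h1_norm \<Omega> (\<lambda>x. u x - \<phi> x)
    = sqrt ((l2_norm \<Omega> (\<lambda>x. u x - \<phi> x))\<^sup>2 + (l2_norm \<Omega> (\<lambda>x. wgrad \<Omega> u x - classical_grad \<phi> x))\<^sup>2)"
proof -
  note \<phi> = test_H1[OF assms(2)]
  have "AE x in M. wgrad \<Omega> (\<lambda>x. u x - \<phi> x) x = wgrad \<Omega> u x - classical_grad \<phi> x"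
    using H1_diff(2)[OF assms(1) \<phi>(1)] \<phi>(2) by eventually_elim simp
  from l2_norm_AE_cong[OF wgrad_L2[OF H1_diff(1)[OF assms(1) \<phi>(1)]] this]
  show ?thesis by (simp add: h1_norm_def)
qed

text \<open>Convergence in the norm of \<open>H\<^sup>1\<close>, rewritten with the classical gradients of the approximating
  functions, so that weak derivatives of differences no longer occur.\<close>

lemma H10_iff:
  "u \<in> H10 \<Omega> \<longleftrightarrow> u \<in> H1 \<Omega> \<and> (\<exists>\<phi>. (\<forall>n::nat. \<phi> n \<in> test_functions \<Omega>)
    \<and> (\<lambda>n. l2_norm \<Omega> (\<lambda>x. u x - \<phi> n x)) \<longlonglongrightarrow> 0
    \<and> (\<lambda>n. l2_norm \<Omega> (\<lambda>x. wgrad \<Omega> u x - classical_grad (\<phi> n) x)) \<longlonglongrightarrow> 0)"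
proof -
  have "(\<lambda>n. h1_norm \<Omega> (\<lambda>x. u x - \<phi> n x)) \<longlonglongrightarrow> 0 \<longleftrightarrow>
      (\<lambda>n. l2_norm \<Omega> (\<lambda>x. u x - \<phi> n x)) \<longlonglongrightarrow> 0
      \<and> (\<lambda>n. l2_norm \<Omega> (\<lambda>x. wgrad \<Omega> u x - classical_grad (\<phi> n) x)) \<longlonglongrightarrow> 0"
    if u: "u \<in> H1 \<Omega>" and \<phi>: "\<forall>n::nat. \<phi> n \<in> test_functions \<Omega>" for \<phi>
  proof -
    let ?a = "\<lambda>n. l2_norm \<Omega> (\<lambda>x. u x - \<phi> n x)"
    let ?b = "\<lambda>n. l2_norm \<Omega> (\<lambda>x. wgrad \<Omega> u x - classical_grad (\<phi> n) x)"
    have h1: "(\<lambda>n. h1_norm \<Omega> (\<lambda>x. u x - \<phi> n x)) = (\<lambda>n. sqrt ((?a n)\<^sup>2 + (?b n)\<^sup>2))"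
      using h1_norm_test_diff[OF u] \<phi> by simp
    show ?thesis
      unfolding h1
    proof (intro iffI conjI)
      assume lim: "(\<lambda>n. sqrt ((?a n)\<^sup>2 + (?b n)\<^sup>2)) \<longlonglongrightarrow> 0"
      show "?a \<longlonglongrightarrow> 0"
        by (rule Lim_null_comparison[OF _ lim])
          (simp add: l2_norm_nonneg real_sqrt_sum_squares_ge1)
      show "?b \<longlonglongrightarrow> 0"
        by (rule Lim_null_comparison[OF _ lim])
          (simp add: l2_norm_nonneg real_sqrt_sum_squares_ge2)
    next
      assume "?a \<longlonglongrightarrow> 0 \<and> ?b \<longlonglongrightarrow> 0"
      then have "(\<lambda>n. sqrt ((?a n)\<^sup>2 + (?b n)\<^sup>2)) \<longlonglongrightarrow> sqrt (0\<^sup>2 + 0\<^sup>2)"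
        by (intro tendsto_intros) auto
      then show "(\<lambda>n. sqrt ((?a n)\<^sup>2 + (?b n)\<^sup>2)) \<longlonglongrightarrow> 0" by simp
    qed
  qed
  then show ?thesis unfolding H10_def by blast
qed

lemma H10_H1: "u \<in> H10 \<Omega> \<Longrightarrow> u \<in> H1 \<Omega>"
  by (simp add: H10_def)

lemma test_H10:
  assumes "\<phi> \<in> test_functions \<Omega>" shows "\<phi> \<in> H10 \<Omega>"
proof -
  note \<phi> = test_H1[OF assms]
  have "AE x in M. wgrad \<Omega> \<phi> x - classical_grad \<phi> x = 0" using \<phi>(2) by simp
  from l2_norm_AE_cong[OF L2_diff[OF wgrad_L2[OF \<phi>(1)] classical_grad_L2[OF assms]] this]
  have "l2_norm \<Omega> (\<lambda>x. wgrad \<Omega> \<phi> x - classical_grad \<phi> x) = 0" by (simp add: l2_norm_def)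
  then show ?thesis
    unfolding H10_iff using assms \<phi>(1) by (intro conjI exI[of _ "\<lambda>n. \<phi>"]) (simp_all add: l2_norm_def)
qed

lemma H10_diff:
  assumes "u \<in> H10 \<Omega>" "v \<in> H10 \<Omega>"
  shows "(\<lambda>x. u x - v x) \<in> H10 \<Omega>"
proof -
  from assms have H1: "u \<in> H1 \<Omega>" "v \<in> H1 \<Omega>" by (simp_all add: H10_H1)
  obtain \<phi> where \<phi>: "\<And>n::nat. \<phi> n \<in> test_functions \<Omega>"
    "(\<lambda>n. l2_norm \<Omega> (\<lambda>x. u x - \<phi> n x)) \<longlonglongrightarrow> 0"
    "(\<lambda>n. l2_norm \<Omega> (\<lambda>x. wgrad \<Omega> u x - classical_grad (\<phi> n) x)) \<longlonglongrightarrow> 0"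
    using assms(1) unfolding H10_iff by blast
  obtain \<psi> where \<psi>: "\<And>n::nat. \<psi> n \<in> test_functions \<Omega>"
    "(\<lambda>n. l2_norm \<Omega> (\<lambda>x. v x - \<psi> n x)) \<longlonglongrightarrow> 0"
    "(\<lambda>n. l2_norm \<Omega> (\<lambda>x. wgrad \<Omega> v x - classical_grad (\<psi> n) x)) \<longlonglongrightarrow> 0"
    using assms(2) unfolding H10_iff by blast
  let ?\<chi> = "\<lambda>n x. \<phi> n x - \<psi> n x"
  have \<chi>: "?\<chi> n \<in> test_functions \<Omega>" for n using \<phi>(1) \<psi>(1) by (simp add: test_diff)
  have "(\<lambda>n. l2_norm \<Omega> (\<lambda>x. (u x - v x) - ?\<chi> n x)) \<longlonglongrightarrow> 0"
  proof (rule Lim_null_comparison)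
    have "l2_norm \<Omega> (\<lambda>x. (u x - v x) - ?\<chi> n x)
        \<le> l2_norm \<Omega> (\<lambda>x. u x - \<phi> n x) + l2_norm \<Omega> (\<lambda>x. v x - \<psi> n x)" for n
    proof -
      have "(\<lambda>x. (u x - v x) - ?\<chi> n x) = (\<lambda>x. (u x - \<phi> n x) - (v x - \<psi> n x))" by auto
      then show ?thesis
        using l2_norm_triangle_diff[of "\<lambda>x. u x - \<phi> n x" "\<lambda>x. v x - \<psi> n x"] H1 \<phi>(1) \<psi>(1)
        by (simp add: L2_diff H1_L2 test_L2)
    qed
    then show "\<forall>\<^sub>F n in sequentially. norm (l2_norm \<Omega> (\<lambda>x. (u x - v x) - ?\<chi> n x))
        \<le> l2_norm \<Omega> (\<lambda>x. u x - \<phi> n x) + l2_norm \<Omega> (\<lambda>x. v x - \<psi> n x)"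
      by (simp add: l2_norm_nonneg)
    show "(\<lambda>n. l2_norm \<Omega> (\<lambda>x. u x - \<phi> n x) + l2_norm \<Omega> (\<lambda>x. v x - \<psi> n x)) \<longlonglongrightarrow> 0"
      using tendsto_add[OF \<phi>(2) \<psi>(2)] by simp
  qed
  moreover have "(\<lambda>n. l2_norm \<Omega> (\<lambda>x. wgrad \<Omega> (\<lambda>x. u x - v x) x - classical_grad (?\<chi> n) x)) \<longlonglongrightarrow> 0"
  proof (rule Lim_null_comparison)
    have "l2_norm \<Omega> (\<lambda>x. wgrad \<Omega> (\<lambda>x. u x - v x) x - classical_grad (?\<chi> n) x)
        \<le> l2_norm \<Omega> (\<lambda>x. wgrad \<Omega> u x - classical_grad (\<phi> n) x)
          + l2_norm \<Omega> (\<lambda>x. wgrad \<Omega> v x - classical_grad (\<psi> n) x)" for n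
    proof -
      have "AE x in M. wgrad \<Omega> (\<lambda>x. u x - v x) x - classical_grad (?\<chi> n) x
          = (wgrad \<Omega> u x - classical_grad (\<phi> n) x) - (wgrad \<Omega> v x - classical_grad (\<psi> n) x)"
        using H1_diff(2)[OF H1]
        by eventually_elim (simp add: classical_grad_diff[OF \<phi>(1) \<psi>(1)])
      then have "l2_norm \<Omega> (\<lambda>x. wgrad \<Omega> (\<lambda>x. u x - v x) x - classical_grad (?\<chi> n) x) = l2_norm \<Omega>
          (\<lambda>x. (wgrad \<Omega> u x - classical_grad (\<phi> n) x) - (wgrad \<Omega> v x - classical_grad (\<psi> n) x))"
        by (intro l2_norm_AE_cong L2_diff wgrad_L2 H1_diff(1) H1 classical_grad_L2 \<chi>)
      also have "\<dots> \<le> l2_norm \<Omega> (\<lambda>x. wgrad \<Omega> u x - classical_grad (\<phi> n) x)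
          + l2_norm \<Omega> (\<lambda>x. wgrad \<Omega> v x - classical_grad (\<psi> n) x)"
        by (intro l2_norm_triangle_diff L2_diff wgrad_L2 H1 classical_grad_L2 \<phi>(1) \<psi>(1))
      finally show ?thesis .
    qed
    then show "\<forall>\<^sub>F n in sequentially.
        norm (l2_norm \<Omega> (\<lambda>x. wgrad \<Omega> (\<lambda>x. u x - v x) x - classical_grad (?\<chi> n) x))
        \<le> l2_norm \<Omega> (\<lambda>x. wgrad \<Omega> u x - classical_grad (\<phi> n) x)
          + l2_norm \<Omega> (\<lambda>x. wgrad \<Omega> v x - classical_grad (\<psi> n) x)"
      by (simp add: l2_norm_nonneg)
    show "(\<lambda>n. l2_norm \<Omega> (\<lambda>x. wgrad \<Omega> u x - classical_grad (\<phi> n) x)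
          + l2_norm \<Omega> (\<lambda>x. wgrad \<Omega> v x - classical_grad (\<psi> n) x)) \<longlonglongrightarrow> 0"
      using tendsto_add[OF \<phi>(3) \<psi>(3)] by simp
  qed
  ultimately show ?thesis
    unfolding H10_iff using H1_diff(1)[OF H1] \<chi> by (intro conjI exI[of _ ?\<chi>]) auto
qed

lemma l2_norm_component_le:
  fixes f :: "real^3 \<Rightarrow> real^3"
  assumes "f \<in> L2 \<Omega>"
  shows "l2_norm \<Omega> (\<lambda>x. f x $ i) \<le> l2_norm \<Omega> f"
proof (rule power2_le_imp_le)
  have "(l2_norm \<Omega> (\<lambda>x. f x $ i))\<^sup>2 \<le> (\<Sum>j\<in>UNIV. (l2_norm \<Omega> (\<lambda>x. f x $ j))\<^sup>2)"
    by (rule member_le_sum) auto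
  then show "(l2_norm \<Omega> (\<lambda>x. f x $ i))\<^sup>2 \<le> (l2_norm \<Omega> f)\<^sup>2"
    by (simp add: l2_norm_squared l2_inner_componentwise[OF assms assms])
qed (simp add: l2_norm_nonneg)

text \<open>Green's formulas: they hold for test functions by definition of the weak derivatives, and
  both sides are continuous in \<open>v\<close> with respect to the norm of \<open>H\<^sup>1\<close>.\<close>

lemma H10_Green_div:
  assumes "v \<in> H10 \<Omega>" "p \<in> Hdiv \<Omega>"
  shows "l2_inner \<Omega> p (wgrad \<Omega> v) = - l2_inner \<Omega> (wdiv \<Omega> p) v"
proof -
  obtain \<phi> where \<phi>: "\<And>n::nat. \<phi> n \<in> test_functions \<Omega>"
    "(\<lambda>n. l2_norm \<Omega> (\<lambda>x. v x - \<phi> n x)) \<longlonglongrightarrow> 0"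
    "(\<lambda>n. l2_norm \<Omega> (\<lambda>x. wgrad \<Omega> v x - classical_grad (\<phi> n) x)) \<longlonglongrightarrow> 0"
    using assms(1) unfolding H10_iff by blast
  note v = H10_H1[OF assms(1)]
  have "(\<lambda>n. l2_inner \<Omega> (classical_grad (\<phi> n)) p) \<longlonglongrightarrow> l2_inner \<Omega> (wgrad \<Omega> v) p"
    by (intro l2_inner_tendsto wgrad_L2 v Hdiv_L2 assms classical_grad_L2 \<phi>)
  moreover have "(\<lambda>n. - l2_inner \<Omega> (\<phi> n) (wdiv \<Omega> p)) \<longlonglongrightarrow> - l2_inner \<Omega> v (wdiv \<Omega> p)"
    by (intro tendsto_minus l2_inner_tendsto H1_L2 v wdiv_L2 assms test_L2 \<phi>)
  moreover have "l2_inner \<Omega> (classical_grad (\<phi> n)) p = - l2_inner \<Omega> (\<phi> n) (wdiv \<Omega> p)" for n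
    using wdiv_test[OF assms(2) \<phi>(1), of n] by (simp add: l2_inner_commute)
  ultimately have "l2_inner \<Omega> (wgrad \<Omega> v) p = - l2_inner \<Omega> v (wdiv \<Omega> p)"
    by (simp add: LIMSEQ_unique)
  then show ?thesis by (simp add: l2_inner_commute)
qed

text \<open>The same passage to the limit for a single partial derivative; it takes the place of Green's
  formula for a scalar function against a solenoidal field.\<close>

lemma H10_Green_partial:
  assumes "v \<in> H10 \<Omega>" "w \<in> H1 \<Omega>"
  shows "l2_inner \<Omega> w (\<lambda>x. wgrad \<Omega> v x $ i) = - l2_inner \<Omega> v (\<lambda>x. wgrad \<Omega> w x $ i)"
proof -
  obtain \<phi> where \<phi>: "\<And>n::nat. \<phi> n \<in> test_functions \<Omega>"
    "(\<lambda>n. l2_norm \<Omega> (\<lambda>x. v x - \<phi> n x)) \<longlonglongrightarrow> 0"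
    "(\<lambda>n. l2_norm \<Omega> (\<lambda>x. wgrad \<Omega> v x - classical_grad (\<phi> n) x)) \<longlonglongrightarrow> 0"
    using assms(1) unfolding H10_iff by blast
  note v = H10_H1[OF assms(1)]
  have "(\<lambda>n. l2_norm \<Omega> (\<lambda>x. wgrad \<Omega> v x $ i - classical_grad (\<phi> n) x $ i)) \<longlonglongrightarrow> 0"
  proof (rule Lim_null_comparison[OF _ \<phi>(3)])
    show "\<forall>\<^sub>F n in sequentially. norm (l2_norm \<Omega> (\<lambda>x. wgrad \<Omega> v x $ i - classical_grad (\<phi> n) x $ i))
        \<le> l2_norm \<Omega> (\<lambda>x. wgrad \<Omega> v x - classical_grad (\<phi> n) x)"
      using l2_norm_component_le[OF L2_diff[OF wgrad_L2[OF v] classical_grad_L2[OF \<phi>(1)]], of _ i]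
      by (simp add: l2_norm_nonneg)
  qed
  then have "(\<lambda>n. l2_inner \<Omega> (\<lambda>x. classical_grad (\<phi> n) x $ i) w) \<longlonglongrightarrow> l2_inner \<Omega> (\<lambda>x. wgrad \<Omega> v x $ i) w"
    by (intro l2_inner_tendsto wgrad_component_L2 v H1_L2 assms test_L2 classical_grad_component_test \<phi>)
  moreover have "(\<lambda>n. - l2_inner \<Omega> (\<phi> n) (\<lambda>x. wgrad \<Omega> w x $ i)) \<longlonglongrightarrow> - l2_inner \<Omega> v (\<lambda>x. wgrad \<Omega> w x $ i)"
    by (intro tendsto_minus l2_inner_tendsto H1_L2 v wgrad_component_L2 assms test_L2 \<phi>)
  moreover have "l2_inner \<Omega> (\<lambda>x. classical_grad (\<phi> n) x $ i) w = - l2_inner \<Omega> (\<phi> n) (\<lambda>x. wgrad \<Omega> w x $ i)" for n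
    using wgrad_test[OF assms(2) \<phi>(1), of n i] by (simp add: l2_inner_commute)
  ultimately have "l2_inner \<Omega> (\<lambda>x. wgrad \<Omega> v x $ i) w = - l2_inner \<Omega> v (\<lambda>x. wgrad \<Omega> w x $ i)"
    by (simp add: LIMSEQ_unique)
  then show ?thesis by (simp add: l2_inner_commute)
qed

lemma vec_grad_L2:
  assumes "\<And>i. (\<lambda>x. v x $ i) \<in> H1 \<Omega>" shows "vec_grad \<Omega> v \<in> L2 \<Omega>"
  unfolding L2_componentwise[where f = "vec_grad \<Omega> v"]
  using assms by (simp add: vec_grad_def wgrad_L2)

lemma row_div_L2:
  assumes "\<And>i. (\<lambda>x. p x $ i) \<in> Hdiv \<Omega>" shows "row_div \<Omega> p \<in> L2 \<Omega>"
  unfolding L2_componentwise[where f = "row_div \<Omega> p"]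
  using assms by (simp add: row_div_def wdiv_L2)

lemma vec_grad_diff:
  assumes "\<And>i. (\<lambda>x. u x $ i) \<in> H1 \<Omega>" "\<And>i. (\<lambda>x. v x $ i) \<in> H1 \<Omega>"
  shows "AE x in M. vec_grad \<Omega> (\<lambda>x. u x - v x) x = vec_grad \<Omega> u x - vec_grad \<Omega> v x"
  by (rule AE_vec_eqI) (use H1_diff(2)[OF assms] in \<open>simp add: vec_grad_def\<close>)

text \<open>A field with components in \<open>H\<^sup>1\<close> has a square-integrable divergence, the trace of its gradient.
  This makes the divergence constraint linear almost everywhere, although the divergence operator
  chooses its representatives arbitrarily.\<close>

lemma wdiv_eq_trace:
  assumes "\<And>i. (\<lambda>x. v x $ i) \<in> H1 \<Omega>"
  shows "v \<in> Hdiv \<Omega>" "AE x in M. wdiv \<Omega> v x = (\<Sum>i\<in>UNIV. vec_grad \<Omega> v x $ i $ i)"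
proof -
  let ?q = "\<lambda>x. \<Sum>i\<in>UNIV. vec_grad \<Omega> v x $ i $ i"
  have v: "v \<in> L2 \<Omega>" using assms by (simp add: L2_componentwise H1_L2)
  have ii: "(\<lambda>x. vec_grad \<Omega> v x $ i $ i) \<in> L2 \<Omega>" for i
    using assms by (simp add: vec_grad_def wgrad_component_L2)
  then have q: "?q \<in> L2 \<Omega>" by (simp add: L2_sum)
  have "l2_inner \<Omega> v (classical_grad \<phi>) = - l2_inner \<Omega> ?q \<phi>" if "\<phi> \<in> test_functions \<Omega>" for \<phi>
  proof -
    have "l2_inner \<Omega> v (classical_grad \<phi>) = (\<Sum>i\<in>UNIV. - l2_inner \<Omega> \<phi> (\<lambda>x. vec_grad \<Omega> v x $ i $ i))"
      using that by (simp add: l2_inner_componentwise v classical_grad_L2 wgrad_test assms vec_grad_def)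
    also have "\<dots> = - l2_inner \<Omega> ?q \<phi>"
      using that ii by (simp add: l2_inner_sum_left test_L2 sum_negf l2_inner_commute[of \<phi>])
    finally show ?thesis .
  qed
  from HdivI[OF v q this] show "v \<in> Hdiv \<Omega>" "AE x in M. wdiv \<Omega> v x = ?q x" by blast+
qed

lemma divfree_components: "v \<in> divfree_H10 \<Omega> \<Longrightarrow> (\<lambda>x. v x $ i) \<in> H10 \<Omega>"
  by (simp add: divfree_H10_def)

lemma divfree_H1: "v \<in> divfree_H10 \<Omega> \<Longrightarrow> (\<lambda>x. v x $ i) \<in> H1 \<Omega>"
  by (simp add: divfree_components H10_H1)

lemma divfree_L2: "v \<in> divfree_H10 \<Omega> \<Longrightarrow> v \<in> L2 \<Omega>"
  by (simp add: L2_componentwise divfree_H1 H1_L2)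

lemma divfree_trace:
  assumes "v \<in> divfree_H10 \<Omega>"
  shows "AE x in M. (\<Sum>i\<in>UNIV. vec_grad \<Omega> v x $ i $ i) = 0"
proof -
  have "AE x in M. wdiv \<Omega> v x = 0" using assms by (simp add: divfree_H10_def)
  with wdiv_eq_trace(2)[OF divfree_H1[OF assms]] show ?thesis by eventually_elim simp
qed

text \<open>Integration by parts moves the gradient from \<open>w\<close> to \<open>v\<close>, where it becomes the divergence. Applied to
  the discrete pressure, this is why the pressure does not enter the error estimate.\<close>

lemma divfree_orthogonal_gradient:
  assumes v: "v \<in> divfree_H10 \<Omega>" and w: "w \<in> H1 \<Omega>"
  shows "l2_inner \<Omega> (wgrad \<Omega> w) v = 0"
proof -
  let ?d = "\<lambda>x. \<Sum>i\<in>UNIV. vec_grad \<Omega> v x $ i $ i"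
  have ii: "(\<lambda>x. vec_grad \<Omega> v x $ i $ i) \<in> L2 \<Omega>" for i
    using v by (simp add: vec_grad_def wgrad_component_L2 divfree_H1)
  have "l2_inner \<Omega> (wgrad \<Omega> w) v = (\<Sum>i\<in>UNIV. l2_inner \<Omega> (\<lambda>x. v x $ i) (\<lambda>x. wgrad \<Omega> w x $ i))"
    using v w by (simp add: l2_inner_componentwise wgrad_L2 divfree_L2 l2_inner_commute)
  also have "\<dots> = (\<Sum>i\<in>UNIV. - l2_inner \<Omega> w (\<lambda>x. vec_grad \<Omega> v x $ i $ i))"
    using v w by (simp add: H10_Green_partial divfree_components vec_grad_def)
  also have "\<dots> = - l2_inner \<Omega> ?d w"
    using w ii by (simp add: l2_inner_sum_left H1_L2 sum_negf l2_inner_commute[of w])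
  also have "l2_inner \<Omega> ?d w = l2_inner \<Omega> (\<lambda>x. 0) w"
    using divfree_trace[OF v] ii w by (intro l2_inner_AE_cong) (simp_all add: L2_sum H1_L2)
  finally show ?thesis by simp
qed

lemma divfree_diff:
  assumes u: "u \<in> divfree_H10 \<Omega>" and v: "v \<in> divfree_H10 \<Omega>"
  shows "(\<lambda>x. u x - v x) \<in> divfree_H10 \<Omega>"
proof -
  let ?w = "\<lambda>x. u x - v x"
  have H10: "(\<lambda>x. ?w x $ i) \<in> H10 \<Omega>" for i
    using H10_diff[OF divfree_components[OF u] divfree_components[OF v]] by simp
  then have "AE x in M. wdiv \<Omega> ?w x = (\<Sum>i\<in>UNIV. vec_grad \<Omega> ?w x $ i $ i)"
    by (intro wdiv_eq_trace) (rule H10_H1)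
  then have "AE x in M. wdiv \<Omega> ?w x = 0"
    using vec_grad_diff[OF divfree_H1[OF u] divfree_H1[OF v]] divfree_trace[OF u] divfree_trace[OF v]
    by eventually_elim (simp add: sum_subtractf)
  with H10 show ?thesis by (simp add: divfree_H10_def)
qed

lemma tensor_Green:
  assumes "\<And>i. (\<lambda>x. v x $ i) \<in> H10 \<Omega>" "\<And>i. (\<lambda>x. p x $ i) \<in> Hdiv \<Omega>"
  shows "l2_inner \<Omega> p (vec_grad \<Omega> v) = - l2_inner \<Omega> (row_div \<Omega> p) v"
proof -
  have p: "p \<in> L2 \<Omega>" unfolding L2_componentwise[where f = p] using assms(2) Hdiv_L2 by blast
  have v: "v \<in> L2 \<Omega>" using assms(1) by (simp add: L2_componentwise H10_H1 H1_L2)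
  have "l2_inner \<Omega> p (vec_grad \<Omega> v) = (\<Sum>i\<in>UNIV. - l2_inner \<Omega> (\<lambda>x. row_div \<Omega> p x $ i) (\<lambda>x. v x $ i))"
    using assms
    by (simp add: l2_inner_componentwise[OF p vec_grad_L2] H10_H1 vec_grad_def row_div_def H10_Green_div)
  then show ?thesis
    using assms(2) v by (simp add: l2_inner_componentwise row_div_L2 sum_negf)
qed

end

section \<open>The L2 projection onto piecewise polynomials\<close>

context finite_domain
begin

text \<open>Gram-Schmidt without normalization: the new vector \<open>b k\<close> is replaced by its component \<open>r\<close>
  orthogonal to the earlier ones, and \<open>w\<close> is corrected along \<open>r\<close>. If \<open>b k\<close> depends
  linearly on the earlier vectors, then \<open>r\<close> vanishes almost everywhere and is orthogonal to everything.\<close>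

lemma finite_span_projection:
  assumes "finite I" "\<And>i. i \<in> I \<Longrightarrow> b i \<in> L2 \<Omega>" "w \<in> L2 \<Omega>"
  shows "\<exists>c :: 'i \<Rightarrow> real. \<forall>i\<in>I. l2_inner \<Omega> (\<lambda>x. w x - (\<Sum>j\<in>I. c j *\<^sub>R b j x)) (b i) = 0"
  using assms
proof (induction I arbitrary: w rule: finite_induct)
  case empty
  then show ?case by simp
next
  case (insert k I)
  have b: "b i \<in> L2 \<Omega>" if "i \<in> I" for i using insert.prems(1) that by simp
  have bk: "b k \<in> L2 \<Omega>" using insert.prems(1) by simp
  note w = insert.prems(2)
  obtain d :: "'i \<Rightarrow> real" where
    d: "\<forall>i\<in>I. l2_inner \<Omega> (\<lambda>x. b k x - (\<Sum>j\<in>I. d j *\<^sub>R b j x)) (b i) = 0"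
    using insert.IH[OF b bk] by blast
  obtain c :: "'i \<Rightarrow> real" where
    c: "\<forall>i\<in>I. l2_inner \<Omega> (\<lambda>x. w x - (\<Sum>j\<in>I. c j *\<^sub>R b j x)) (b i) = 0"
    using insert.IH[OF b w] by blast
  define r where "r = (\<lambda>x. b k x - (\<Sum>j\<in>I. d j *\<^sub>R b j x))"
  define w0 where "w0 = (\<lambda>x. w x - (\<Sum>j\<in>I. c j *\<^sub>R b j x))"
  have sum_L2: "(\<lambda>x. \<Sum>j\<in>I. e j *\<^sub>R b j x) \<in> L2 \<Omega>" for e :: "'i \<Rightarrow> real"
    using b insert.hyps(1) by (simp add: L2_sum L2_scaleR)
  have r: "r \<in> L2 \<Omega>" and w0: "w0 \<in> L2 \<Omega>"
    unfolding r_def w0_def using bk w sum_L2 by (simp_all add: L2_diff)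
  \<comment> \<open>If \<open>(r, r) = 0\<close>, division by 0 gives \<open>t = 0\<close>, and \<open>r\<close> is orthogonal to everything anyway.\<close>
  define t where "t = l2_inner \<Omega> w0 r / l2_inner \<Omega> r r"
  define w1 where "w1 = (\<lambda>x. w0 x - t *\<^sub>R r x)"
  have w1: "w1 \<in> L2 \<Omega>" unfolding w1_def using w0 r by (simp add: L2_diff L2_scaleR)
  have w1_inner: "l2_inner \<Omega> w1 h = l2_inner \<Omega> w0 h - t * l2_inner \<Omega> r h" if "h \<in> L2 \<Omega>" for h
    unfolding w1_def using w0 r that by (simp add: l2_inner_diff_left L2_scaleR l2_inner_scaleR_left)
  have orth_I: "l2_inner \<Omega> w1 (b i) = 0" if "i \<in> I" for i
    using c d that b unfolding w1_inner[OF b[OF that]] by (simp add: w0_def r_def)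
  have orth_r: "l2_inner \<Omega> w1 r = 0"
  proof (cases "l2_inner \<Omega> r r = 0")
    case True
    then have "l2_norm \<Omega> r = 0" by (simp add: l2_norm_def)
    then show ?thesis using l2_Cauchy_Schwarz[OF w1 r] by simp
  next
    case False
    then show ?thesis unfolding w1_inner[OF r] by (simp add: t_def)
  qed
  have "l2_inner \<Omega> w1 (\<lambda>x. \<Sum>j\<in>I. d j *\<^sub>R b j x) = 0"
  proof -
    have "l2_inner \<Omega> (\<lambda>x. \<Sum>j\<in>I. d j *\<^sub>R b j x) w1 = (\<Sum>j\<in>I. d j * l2_inner \<Omega> (b j) w1)"
      using b insert.hyps(1) w1 by (simp add: l2_inner_sum_left L2_scaleR l2_inner_scaleR_left)
    also have "\<dots> = 0"
      using orth_I by (intro sum.neutral) (simp add: l2_inner_commute[where g = w1])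
    finally show ?thesis by (simp add: l2_inner_commute)
  qed
  moreover have "b k = (\<lambda>x. r x + (\<Sum>j\<in>I. d j *\<^sub>R b j x))" by (simp add: r_def)
  ultimately have orth_k: "l2_inner \<Omega> w1 (b k) = 0"
    using l2_inner_add_right[OF r sum_L2 w1] orth_r by simp
  let ?e = "\<lambda>j. if j = k then t else c j - t * d j"
  have "(\<Sum>j\<in>insert k I. ?e j *\<^sub>R b j x) = t *\<^sub>R b k x + (\<Sum>j\<in>I. (c j - t * d j) *\<^sub>R b j x)" for x
  proof -
    have "(\<Sum>j\<in>I. ?e j *\<^sub>R b j x) = (\<Sum>j\<in>I. (c j - t * d j) *\<^sub>R b j x)"
      using insert.hyps(2) by (intro sum.cong) auto
    then show ?thesis using insert.hyps by simp
  qed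
  then have "w x - (\<Sum>j\<in>insert k I. ?e j *\<^sub>R b j x) = w1 x" for x
    by (simp add: w1_def w0_def r_def scaleR_diff_left scaleR_diff_right sum_subtractf scaleR_sum_right)
  then have "\<forall>i\<in>insert k I. l2_inner \<Omega> (\<lambda>x. w x - (\<Sum>j\<in>insert k I. ?e j *\<^sub>R b j x)) (b i) = 0"
    using orth_I orth_k by simp
  then show ?case by (rule exI[of _ ?e])
qed

end

definition multiindices :: "nat \<Rightarrow> (3 \<Rightarrow> nat) set" where
  "multiindices d = {\<alpha>. (\<Sum>i\<in>UNIV. \<alpha> i) \<le> d}"

text \<open>The index pairs a cell with a multiindex; these functions span the piecewise polynomials up to
  null sets.\<close>

definition cell_monomial :: "(real^3) set \<times> (3 \<Rightarrow> nat) \<Rightarrow> real^3 \<Rightarrow> real" where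
  "cell_monomial = (\<lambda>(K, \<alpha>) x. indicator K x * (\<Prod>i\<in>UNIV. (x $ i) ^ \<alpha> i))"

lemma finite_multiindices: "finite (multiindices d)"
proof (rule finite_subset)
  have "\<alpha> i \<le> (\<Sum>i\<in>UNIV. \<alpha> i)" for \<alpha> :: "3 \<Rightarrow> nat" and i by (rule member_le_sum) auto
  then show "multiindices d \<subseteq> (\<Pi>\<^sub>E i\<in>UNIV. {..d})"
    unfolding multiindices_def by (auto intro: order_trans)
  show "finite (\<Pi>\<^sub>E i\<in>(UNIV :: 3 set). {..d})" by (intro finite_PiE) auto
qed

lemma polys_iff: "p \<in> polys d \<longleftrightarrow>
    (\<exists>c. p = (\<lambda>x. \<Sum>\<alpha>\<in>multiindices d. c \<alpha> * (\<Prod>i\<in>UNIV. (x $ i) ^ \<alpha> i)))"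
  by (simp add: polys_def multiindices_def)

locale meshed_domain = open_domain +
  fixes \<T> :: "(real^3) set set"
  assumes mesh: "tetrahedral_mesh \<Omega> \<T>"
begin

lemma finite_cells: "finite \<T>"
  using mesh by (simp add: tetrahedral_mesh_def triangulation_def)

lemma cell_simplex: "K \<in> \<T> \<Longrightarrow> 3 simplex K"
  using mesh by (simp add: tetrahedral_mesh_def)

lemma cell_sets: "K \<in> \<T> \<Longrightarrow> K \<in> sets lebesgue"
  using closed_simplex[OF cell_simplex] by simp

text \<open>The intersection is a face of both tetrahedra and a proper face of at least one of them, hence of
  dimension less than 3.\<close>

lemma cells_overlap_negligible:
  assumes "K \<in> \<T>" "K' \<in> \<T>" "K \<noteq> K'"
  shows "negligible (K \<inter> K')"
proof -
  have faces: "K \<inter> K' face_of K" "K' \<inter> K face_of K'"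
    using assms mesh by (auto simp: tetrahedral_mesh_def triangulation_def)
  have dims: "aff_dim K = 3" "aff_dim K' = 3"
    using assms cell_simplex aff_dim_simplex by blast+
  have "aff_dim (K \<inter> K') < 3"
  proof (cases "K \<inter> K' = K")
    case False
    from face_of_aff_dim_lt[OF convex_simplex[OF cell_simplex[OF assms(1)]] faces(1) this]
    show ?thesis by (simp add: dims)
  next
    case True
    with assms(3) have "K' \<inter> K \<noteq> K'" by blast
    from face_of_aff_dim_lt[OF convex_simplex[OF cell_simplex[OF assms(2)]] faces(2) this]
    show ?thesis by (simp add: dims Int_commute)
  qed
  then have "interior (K \<inter> K') = {}" using aff_dim_nonempty_interior[of "K \<inter> K'"] by auto
  moreover have "convex (K \<inter> K')"
    using assms cell_simplex convex_simplex by (meson convex_Int)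
  ultimately show ?thesis by (simp add: negligible_convex_interior)
qed

lemma AE_unique_cell:
  "AE x in lebesgue. \<forall>K\<in>\<T>. \<forall>K'\<in>\<T>. x \<in> K \<longrightarrow> x \<in> K' \<longrightarrow> K' = K"
proof -
  have "AE x in lebesgue. x \<in> K \<longrightarrow> x \<in> K' \<longrightarrow> K' = K" if "K \<in> \<T>" "K' \<in> \<T>" for K K'
  proof (cases "K = K'")
    case False
    then have "AE x in lebesgue. x \<notin> K \<inter> K'"
      using cells_overlap_negligible[OF that] by (intro AE_not_in) (simp add: negligible_iff_null_sets)
    then show ?thesis by eventually_elim simp
  qed simp
  then show ?thesis by (intro AE_finite_allI finite_cells)
qed

lemma cell_monomial_L2:
  assumes "K \<in> \<T>" shows "cell_monomial (K, \<alpha>) \<in> L2 \<Omega>"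
proof -
  let ?m = "\<lambda>x :: real^3. \<Prod>i\<in>UNIV. (x $ i) ^ \<alpha> i"
  have cont: "continuous_on S ?m" for S by (intro continuous_intros)
  have "bounded (?m ` K)"
    by (intro compact_imp_bounded compact_continuous_image cont compact_simplex[OF cell_simplex[OF assms]])
  then obtain B where B: "B > 0" "\<And>x. x \<in> K \<Longrightarrow> \<bar>?m x\<bar> \<le> B" by (auto simp: bounded_pos)
  show ?thesis
  proof (rule bounded_measurable_L2)
    have "(\<lambda>x. indicator K x * ?m x) \<in> borel_measurable lebesgue"
      using cell_sets[OF assms]
      by (intro borel_measurable_times borel_measurable_indicator measurable_completion)
        (simp_all add: borel_measurable_continuous_onI cont)
    then show "cell_monomial (K, \<alpha>) \<in> borel_measurable M"
      by (simp add: cell_monomial_def measurable_restrict_space1)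
    show "norm (cell_monomial (K, \<alpha>) x) \<le> B" for x
      using B by (auto simp: cell_monomial_def indicator_def)
  qed
qed

lemma cell_combination_on_cell:
  assumes "x \<in> K" "K \<in> \<T>" "\<forall>K'\<in>\<T>. x \<in> K' \<longrightarrow> K' = K"
  shows "(\<Sum>j\<in>\<T> \<times> multiindices d. c j *\<^sub>R cell_monomial j x)
    = (\<Sum>\<alpha>\<in>multiindices d. c (K, \<alpha>) * (\<Prod>i\<in>UNIV. (x $ i) ^ \<alpha> i))"
proof -
  have "(\<Sum>j\<in>\<T> \<times> multiindices d. c j *\<^sub>R cell_monomial j x)
      = (\<Sum>K'\<in>\<T>. \<Sum>\<alpha>\<in>multiindices d. c (K', \<alpha>) *\<^sub>R cell_monomial (K', \<alpha>) x)"
    by (simp add: sum.cartesian_product)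
  also have "\<dots> = (\<Sum>K'\<in>\<T>. if K' = K then \<Sum>\<alpha>\<in>multiindices d. c (K, \<alpha>) * (\<Prod>i\<in>UNIV. (x $ i) ^ \<alpha> i) else 0)"
  proof (intro sum.cong refl)
    fix K' assume K': "K' \<in> \<T>"
    show "(\<Sum>\<alpha>\<in>multiindices d. c (K', \<alpha>) *\<^sub>R cell_monomial (K', \<alpha>) x)
        = (if K' = K then \<Sum>\<alpha>\<in>multiindices d. c (K, \<alpha>) * (\<Prod>i\<in>UNIV. (x $ i) ^ \<alpha> i) else 0)"
    proof (cases "K' = K")
      case True
      with assms(1) show ?thesis by (simp add: cell_monomial_def)
    next
      case False
      with assms(3) K' have "x \<notin> K'" by blast
      with False show ?thesis by (simp add: cell_monomial_def)
    qed
  qed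
  finally show ?thesis using assms(2) finite_cells by simp
qed

lemma AE_lebesgue_on_cell:
  "K \<in> \<T> \<Longrightarrow> (AE x in lebesgue_on K. P x) \<longleftrightarrow> (AE x in lebesgue. x \<in> K \<longrightarrow> P x)"
  using cell_sets by (subst AE_restrict_space_iff) simp_all

lemma cell_combination_in_X_h:
  "(\<lambda>x. \<Sum>j\<in>\<T> \<times> multiindices d. c j *\<^sub>R cell_monomial j x) \<in> X_h \<T> d"
  unfolding X_h_def
proof (intro CollectI ballI)
  fix K assume K: "K \<in> \<T>"
  show "\<exists>p\<in>polys d. AE x in lebesgue_on K. (\<Sum>j\<in>\<T> \<times> multiindices d. c j *\<^sub>R cell_monomial j x) = p x"
    unfolding AE_lebesgue_on_cell[OF K]
  proof (intro bexI)
    show "AE x in lebesgue. x \<in> K \<longrightarrow> (\<Sum>j\<in>\<T> \<times> multiindices d. c j *\<^sub>R cell_monomial j x)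
        = (\<Sum>\<alpha>\<in>multiindices d. c (K, \<alpha>) * (\<Prod>i\<in>UNIV. (x $ i) ^ \<alpha> i))"
      using AE_unique_cell
      proof eventually_elim
        case (elim x)
        then show ?case using K by (intro impI cell_combination_on_cell) blast+
      qed
    show "(\<lambda>x. \<Sum>\<alpha>\<in>multiindices d. c (K, \<alpha>) * (\<Prod>i\<in>UNIV. (x $ i) ^ \<alpha> i)) \<in> polys d"
      by (auto simp: polys_iff)
  qed
qed

text \<open>Almost every point of the domain lies in exactly one cell, where only the monomials of that cell
  contribute.\<close>

lemma X_h_AE_cell_combination:
  assumes "g \<in> X_h \<T> d"
  obtains c where "AE x in M. (\<Sum>j\<in>\<T> \<times> multiindices d. c j *\<^sub>R cell_monomial j x) = g x"
proof -
  have "\<exists>c. AE x in lebesgue_on K. g x = (\<Sum>\<alpha>\<in>multiindices d. c \<alpha> * (\<Prod>i\<in>UNIV. (x $ i) ^ \<alpha> i))"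
    if "K \<in> \<T>" for K
  proof -
    from assms that obtain p where "p \<in> polys d" "AE x in lebesgue_on K. g x = p x"
      unfolding X_h_def by blast
    then show ?thesis unfolding polys_iff by blast
  qed
  then have "\<forall>K\<in>\<T>. \<exists>c. AE x in lebesgue_on K.
      g x = (\<Sum>\<alpha>\<in>multiindices d. c \<alpha> * (\<Prod>i\<in>UNIV. (x $ i) ^ \<alpha> i))" by blast
  from bchoice[OF this] obtain c where c: "\<forall>K\<in>\<T>.
      AE x in lebesgue_on K. g x = (\<Sum>\<alpha>\<in>multiindices d. c K \<alpha> * (\<Prod>i\<in>UNIV. (x $ i) ^ \<alpha> i))"
    by blast
  then have "AE x in lebesgue. \<forall>K\<in>\<T>. x \<in> K \<longrightarrow>
      g x = (\<Sum>\<alpha>\<in>multiindices d. c K \<alpha> * (\<Prod>i\<in>UNIV. (x $ i) ^ \<alpha> i))"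
    by (intro AE_finite_allI finite_cells) (simp add: AE_lebesgue_on_cell)
  then have "AE x in lebesgue. x \<in> \<Omega> \<longrightarrow>
      (\<Sum>j\<in>\<T> \<times> multiindices d. c (fst j) (snd j) *\<^sub>R cell_monomial j x) = g x"
    using AE_unique_cell
  proof eventually_elim
    case (elim x)
    show ?case
    proof
      assume "x \<in> \<Omega>"
      then have "x \<in> \<Union>\<T>" using mesh closure_subset by (auto simp: tetrahedral_mesh_def)
      then obtain K where K: "x \<in> K" "K \<in> \<T>" by blast
      then show "(\<Sum>j\<in>\<T> \<times> multiindices d. c (fst j) (snd j) *\<^sub>R cell_monomial j x) = g x"
      proof (subst cell_combination_on_cell[OF K])
        show "\<forall>K'\<in>\<T>. x \<in> K' \<longrightarrow> K' = K" using K elim(2) by blast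
        show "(\<Sum>\<alpha>\<in>multiindices d. c (fst (K, \<alpha>)) (snd (K, \<alpha>)) * (\<Prod>i\<in>UNIV. (x $ i) ^ \<alpha> i)) = g x"
          using K elim(1) by simp
      qed
    qed
  qed
  then have "AE x in M. (\<Sum>j\<in>\<T> \<times> multiindices d. c (fst j) (snd j) *\<^sub>R cell_monomial j x) = g x"
    by (subst AE_restrict_space_iff[OF domain_sets]) simp
  then show thesis by (rule that)
qed

lemma cell_combination_L2: "(\<lambda>x. \<Sum>j\<in>\<T> \<times> multiindices d. c j *\<^sub>R cell_monomial j x) \<in> L2 \<Omega>"
  using finite_cells finite_multiindices
  by (intro L2_sum L2_scaleR finite_cartesian_product) (auto simp: cell_monomial_L2)

lemma X_h_L2: "g \<in> X_h \<T> d \<Longrightarrow> g \<in> L2 \<Omega>"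
  by (erule X_h_AE_cell_combination) (rule L2_AE_cong[OF cell_combination_L2])

lemma X_h_projection:
  fixes w :: "real^3 \<Rightarrow> real"
  assumes "w \<in> L2 \<Omega>"
  obtains w\<^sub>h where "w\<^sub>h \<in> X_h \<T> d" "\<And>g. g \<in> X_h \<T> d \<Longrightarrow> l2_inner \<Omega> (\<lambda>x. w x - w\<^sub>h x) g = 0"
proof -
  let ?I = "\<T> \<times> multiindices d"
  have fin: "finite ?I" using finite_cells finite_multiindices by simp
  have L2s: "cell_monomial i \<in> L2 \<Omega>" if "i \<in> ?I" for i using that cell_monomial_L2 by auto
  from finite_span_projection[OF fin L2s assms] obtain c where c: "\<forall>i\<in>?I.
      l2_inner \<Omega> (\<lambda>x. w x - (\<Sum>j\<in>?I. c j *\<^sub>R cell_monomial j x)) (cell_monomial i) = 0" ..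
  let ?w = "\<lambda>x. \<Sum>j\<in>?I. c j *\<^sub>R cell_monomial j x"
  have r: "(\<lambda>x. w x - ?w x) \<in> L2 \<Omega>" using assms cell_combination_L2 by (rule L2_diff)
  have "l2_inner \<Omega> (\<lambda>x. w x - ?w x) g = 0" if g: "g \<in> X_h \<T> d" for g
  proof -
    obtain e where e: "AE x in M. (\<Sum>j\<in>?I. e j *\<^sub>R cell_monomial j x) = g x"
      using X_h_AE_cell_combination[OF g] .
    have "l2_inner \<Omega> g (\<lambda>x. w x - ?w x) = l2_inner \<Omega> (\<lambda>x. \<Sum>j\<in>?I. e j *\<^sub>R cell_monomial j x) (\<lambda>x. w x - ?w x)"
      by (rule l2_inner_AE_cong[symmetric, OF cell_combination_L2 r e]) simp
    also have "\<dots> = (\<Sum>j\<in>?I. e j * l2_inner \<Omega> (cell_monomial j) (\<lambda>x. w x - ?w x))"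
      using fin r L2s
      by (simp only: l2_inner_sum_left L2_scaleR l2_inner_scaleR_left)
    also have "\<dots> = 0"
    proof (intro sum.neutral ballI)
      fix j assume "j \<in> ?I"
      from bspec[OF c this] have "l2_inner \<Omega> (cell_monomial j) (\<lambda>x. w x - ?w x) = 0"
        by (subst l2_inner_commute)
      then show "e j * l2_inner \<Omega> (cell_monomial j) (\<lambda>x. w x - ?w x) = 0" by simp
    qed
    finally show ?thesis by (simp add: l2_inner_commute)
  qed
  then show thesis by (rule that[OF cell_combination_in_X_h])
qed

lemma vec_X_h_L2: "w \<in> vec_X_h \<T> d \<Longrightarrow> w \<in> L2 \<Omega>"
  using X_h_L2 by (auto simp: L2_componentwise vec_X_h_def)

text \<open>The estimate \<open>\<parallel>w - w\<^sub>h\<parallel> \<le> C\<^sub>0\<^sub>h \<parallel>\<nabla>w\<parallel>\<close> is available only for a \<open>w\<^sub>h\<close> that is a projection of \<open>w\<close>, so it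
  says nothing about a field until a projection of it has been found.\<close>

lemma pi_h_exists:
  assumes "w \<in> L2 \<Omega>"
  obtains w\<^sub>h where "is_pi_h \<Omega> \<T> d w w\<^sub>h"
proof -
  have "\<exists>p. p \<in> X_h \<T> d \<and> (\<forall>g\<in>X_h \<T> d. l2_inner \<Omega> (\<lambda>x. w x $ i - p x) g = 0)" for i
  proof -
    have "(\<lambda>x. w x $ i) \<in> L2 \<Omega>" using assms by (simp add: L2_componentwise)
    then obtain p where "p \<in> X_h \<T> d" "\<And>g. g \<in> X_h \<T> d \<Longrightarrow> l2_inner \<Omega> (\<lambda>x. w x $ i - p x) g = 0"
      using X_h_projection by metis
    then show ?thesis by blast
  qed
  then have "\<forall>i. \<exists>p. p \<in> X_h \<T> d \<and> (\<forall>g\<in>X_h \<T> d. l2_inner \<Omega> (\<lambda>x. w x $ i - p x) g = 0)" ..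
  from choice[OF this] obtain p where p: "\<And>i. p i \<in> X_h \<T> d"
    "\<And>i g. g \<in> X_h \<T> d \<Longrightarrow> l2_inner \<Omega> (\<lambda>x. w x $ i - p i x) g = 0"
    by blast
  let ?w = "\<lambda>x. \<chi> i. p i x"
  have w: "?w \<in> vec_X_h \<T> d" using p(1) by (simp add: vec_X_h_def)
  have "l2_inner \<Omega> (\<lambda>x. w x - ?w x) g = 0" if g: "g \<in> vec_X_h \<T> d" for g
  proof -
    have "l2_inner \<Omega> (\<lambda>x. w x - ?w x) g
        = (\<Sum>i\<in>UNIV. l2_inner \<Omega> (\<lambda>x. (w x - ?w x) $ i) (\<lambda>x. g x $ i))"
      by (intro l2_inner_componentwise L2_diff assms vec_X_h_L2[OF w] vec_X_h_L2[OF g])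
    also have "\<dots> = 0" using g p(2) by (simp add: vec_X_h_def)
    finally show ?thesis .
  qed
  with w show thesis by (intro that[of ?w]) (simp add: is_pi_h_def)
qed

end

section \<open>A solenoidal field with nonzero gradient\<close>

definition bump :: "real \<Rightarrow> real \<Rightarrow> real \<Rightarrow> real" where
  "bump l r t = flat 0 (t - l) * flat 0 (r - t)"

definition bump_deriv :: "real \<Rightarrow> real \<Rightarrow> real \<Rightarrow> real" where
  "bump_deriv l r t = flat 2 (t - l) * flat 0 (r - t) - flat 0 (t - l) * flat 2 (r - t)"

lemma bump_has_real_derivative: "(bump l r has_real_derivative bump_deriv l r t) (at t)"
proof -
  have "((\<lambda>t. flat 0 (t - l)) has_real_derivative flat 2 (t - l) * 1) (at t)"
    by (rule DERIV_chain2[where f = "flat 0"])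
      (use flat_has_real_derivative[of 0 "t - l"] in
        \<open>auto intro!: derivative_eq_intros simp: numeral_2_eq_2\<close>)
  moreover have "((\<lambda>t. flat 0 (r - t)) has_real_derivative flat 2 (r - t) * (- 1)) (at t)"
    by (rule DERIV_chain2[where f = "flat 0"])
      (use flat_has_real_derivative[of 0 "r - t"] in
        \<open>auto intro!: derivative_eq_intros simp: numeral_2_eq_2\<close>)
  ultimately show ?thesis
    unfolding bump_def[abs_def] bump_deriv_def
    by (auto intro!: derivative_eq_intros simp: algebra_simps)
qed

lemma bump_zero: "t \<le> l \<or> r \<le> t \<Longrightarrow> bump l r t = 0"
  by (auto simp: bump_def flat_def)

lemma bump_deriv_zero: "t \<le> l \<or> r \<le> t \<Longrightarrow> bump_deriv l r t = 0"
  by (auto simp: bump_deriv_def flat_def)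

lemma bump_pos: "l < t \<Longrightarrow> t < r \<Longrightarrow> bump l r t > 0"
  by (simp add: bump_def flat_def)

text \<open>On the left half of the interval the bump still increases. This explicit region of strict
  monotonicity serves to certify that a gradient is not zero.\<close>

lemma bump_deriv_pos:
  assumes "l < t" "t < (l + r) / 2" shows "bump_deriv l r t > 0"
proof -
  let ?a = "t - l" and ?b = "r - t"
  have ab: "0 < ?a" "?a < ?b" using assms by (auto simp: field_simps)
  have "bump_deriv l r t = exp (- (1 / ?a)) * exp (- (1 / ?b)) * (1 / ?a\<^sup>2 - 1 / ?b\<^sup>2)"
    using ab by (simp add: bump_deriv_def flat_def algebra_simps)
  moreover have "?a\<^sup>2 < ?b\<^sup>2" using ab by (intro power_strict_mono) auto
  then have "1 / ?b\<^sup>2 < 1 / ?a\<^sup>2" using ab by (intro divide_strict_left_mono) auto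
  ultimately show ?thesis by simp
qed

lemma flat_algebra_bump: "flat_algebra (\<lambda>x. bump l r (x $ i))"
  unfolding bump_def
  using flat_algebra.mult[OF flat_algebra_coordinate[of 0 1 i l] flat_algebra_coordinate'[of 0 1 r i]]
  by simp

lemma flat_algebra_bump_deriv: "flat_algebra (\<lambda>x. bump_deriv l r (x $ i))"
  unfolding bump_deriv_def
  using flat_algebra_diff[OF
    flat_algebra.mult[OF flat_algebra_coordinate[of 2 1 i l] flat_algebra_coordinate'[of 0 1 r i]]
    flat_algebra.mult[OF flat_algebra_coordinate[of 0 1 i l] flat_algebra_coordinate'[of 2 1 r i]]]
  by simp

text \<open>Partial derivatives of products of one-dimensional functions are computed along coordinate lines.\<close>

lemma classical_grad_component_eqI:
  assumes "smooth \<phi>" "((\<lambda>t. \<phi> (x + t *\<^sub>R axis i 1)) has_real_derivative D) (at 0)"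
  shows "classical_grad \<phi> x $ i = D"
proof -
  have "((\<lambda>t. x + t *\<^sub>R axis i 1) has_derivative (\<lambda>s. s *\<^sub>R axis i 1)) (at 0)"
    by (auto intro!: derivative_eq_intros)
  moreover have "(\<phi> has_derivative frechet_derivative \<phi> (at x)) (at (x + 0 *\<^sub>R axis i 1))"
    using smooth_has_derivative[OF assms(1), of x] by simp
  ultimately have "((\<lambda>t. \<phi> (x + t *\<^sub>R axis i 1)) has_derivative
      (\<lambda>s. frechet_derivative \<phi> (at x) (s *\<^sub>R axis i 1))) (at 0)"
    by (rule has_derivative_compose)
  moreover have "((\<lambda>t. \<phi> (x + t *\<^sub>R axis i 1)) has_derivative (\<lambda>s. D * s)) (at 0)"
    using assms(2) by (simp add: has_field_derivative_def)
  ultimately have "(\<lambda>s. frechet_derivative \<phi> (at x) (s *\<^sub>R axis i 1)) = (\<lambda>s. D * s)"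
    by (rule has_derivative_unique)
  from fun_cong[OF this, of 1] show ?thesis by (simp add: classical_grad_component)
qed

context open_domain
begin

text \<open>The field is the curl of a bump \<open>\<beta>\<^sub>1 \<beta>\<^sub>2 \<beta>\<^sub>3\<close> about the third axis, \<open>(\<beta>\<^sub>1 \<beta>\<^sub>2' \<beta>\<^sub>3, - \<beta>\<^sub>1' \<beta>\<^sub>2 \<beta>\<^sub>3, 0)\<close>. The
  product form makes the cancellation in the divergence explicit, without an appeal to the symmetry
  of second derivatives. The first diagonal entry of its gradient, \<open>\<beta>\<^sub>1' \<beta>\<^sub>2' \<beta>\<^sub>3\<close>, is positive on a
  box.\<close>

lemma divfree_field_nonzero_gradient:
  assumes "\<Omega> \<noteq> {}"
  obtains v where "v \<in> divfree_H10 \<Omega>" "l2_norm \<Omega> (vec_grad \<Omega> v) > 0"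
proof -
  obtain x\<^sub>0 where "x\<^sub>0 \<in> \<Omega>" using assms by blast
  then obtain l r where lr: "x\<^sub>0 \<in> box l r" "cbox l r \<subseteq> \<Omega>"
    using open_contains_cbox[of \<Omega>] open_domain by metis
  let ?\<beta> = "\<lambda>i x. bump (l $ i) (r $ i) (x $ i)"
  let ?\<gamma> = "\<lambda>i x. bump_deriv (l $ i) (r $ i) (x $ i)"
  define v1 v2 where "v1 = (\<lambda>x. ?\<beta> 1 x * (?\<gamma> 2 x * ?\<beta> 3 x))"
    and "v2 = (\<lambda>x. (- 1) * (?\<beta> 2 x * (?\<gamma> 1 x * ?\<beta> 3 x)))"
  define v where "v = (\<lambda>x. vector [v1 x, v2 x, 0] :: real^3)"
  have sm: "smooth v1" "smooth v2" "smooth (\<lambda>x. 0)"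
    unfolding v1_def v2_def
    by (rule flat_algebra_smooth,
        (rule flat_algebra.mult flat_algebra_bump flat_algebra_bump_deriv flat_algebra.const)+)+
  have out: "v1 x = 0" "v2 x = 0" if x: "x \<notin> cbox l r" for x
  proof -
    obtain i where "\<not> (l $ i \<le> x $ i \<and> x $ i \<le> r $ i)"
      using x by (auto simp: mem_box_cart)
    then have "x $ i \<le> l $ i \<or> r $ i \<le> x $ i" by linarith
    then have "?\<beta> i x = 0" "?\<gamma> i x = 0" by (simp_all add: bump_zero bump_deriv_zero)
    then show "v1 x = 0" "v2 x = 0" using exhaust_3[of i] by (auto simp: v1_def v2_def)
  qed
  have test: "v1 \<in> test_functions \<Omega>" "v2 \<in> test_functions \<Omega>" "(\<lambda>x. 0) \<in> test_functions \<Omega>"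
    by (rule test_functionI[OF _ compact_cbox lr(2)], rule sm, rule out, assumption)+
      (rule test_functionI[OF _ compact_cbox lr(2)], rule sm, rule refl)
  have grad1: "classical_grad v1 x $ 1 = ?\<gamma> 1 x * (?\<gamma> 2 x * ?\<beta> 3 x)" for x
  proof (rule classical_grad_component_eqI[OF sm(1)])
    have "((\<lambda>t. bump (l $ 1) (r $ 1) (x $ 1 + t)) has_real_derivative ?\<gamma> 1 x * 1) (at 0)"
      by (rule DERIV_chain2[where f = "bump (l $ 1) (r $ 1)"])
        (use bump_has_real_derivative in \<open>auto intro!: derivative_eq_intros\<close>)
    from DERIV_cmult_right[OF this, of "?\<gamma> 2 x * ?\<beta> 3 x"]
    show "((\<lambda>t. v1 (x + t *\<^sub>R axis 1 1)) has_real_derivative ?\<gamma> 1 x * (?\<gamma> 2 x * ?\<beta> 3 x)) (at 0)"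
      by (simp add: v1_def axis_def)
  qed
  have grad2: "classical_grad v2 x $ 2 = - (?\<gamma> 1 x * (?\<gamma> 2 x * ?\<beta> 3 x))" for x
  proof (rule classical_grad_component_eqI[OF sm(2)])
    have "((\<lambda>t. bump (l $ 2) (r $ 2) (x $ 2 + t)) has_real_derivative ?\<gamma> 2 x * 1) (at 0)"
      by (rule DERIV_chain2[where f = "bump (l $ 2) (r $ 2)"])
        (use bump_has_real_derivative in \<open>auto intro!: derivative_eq_intros\<close>)
    from DERIV_cmult[OF DERIV_cmult_right[OF this, of "?\<gamma> 1 x * ?\<beta> 3 x"], of "- 1"]
    show "((\<lambda>t. v2 (x + t *\<^sub>R axis 2 1)) has_real_derivative - (?\<gamma> 1 x * (?\<gamma> 2 x * ?\<beta> 3 x))) (at 0)"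
      by (simp add: v2_def axis_def algebra_simps)
  qed
  have grad3: "classical_grad (\<lambda>x. 0) x $ 3 = 0" for x
    by (rule classical_grad_component_eqI[OF sm(3)]) simp
  have comp: "(\<lambda>x. v x $ 1) = v1" "(\<lambda>x. v x $ 2) = v2" "(\<lambda>x. v x $ 3) = (\<lambda>x. 0)"
    by (simp_all only: v_def vector_3)
  have "\<forall>i. (\<lambda>x. v x $ i) \<in> H10 \<Omega>"
    unfolding forall_3 comp using test[THEN test_H10] by blast
  then have H10: "(\<lambda>x. v x $ i) \<in> H10 \<Omega>" for i ..
  note H1 = H10_H1[OF H10]
  have grads: "AE x in M. vec_grad \<Omega> v x $ 1 = classical_grad v1 x"
    "AE x in M. vec_grad \<Omega> v x $ 2 = classical_grad v2 x"
    "AE x in M. vec_grad \<Omega> v x $ 3 = classical_grad (\<lambda>x. 0) x"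
    using test[THEN test_H1(2)] by (simp_all only: vec_grad_def vec_lambda_beta comp)
  have "AE x in M. wdiv \<Omega> v x = (\<Sum>i\<in>UNIV. vec_grad \<Omega> v x $ i $ i)"
    by (rule wdiv_eq_trace[OF H1])
  then have "AE x in M. wdiv \<Omega> v x = 0"
    using grads by eventually_elim (simp add: sum_3 grad1 grad2 grad3)
  then have v: "v \<in> divfree_H10 \<Omega>" using H10 by (simp add: divfree_H10_def)
  have "l2_norm \<Omega> (vec_grad \<Omega> v) \<noteq> 0"
  proof
    assume "l2_norm \<Omega> (vec_grad \<Omega> v) = 0"
    then have "AE x in M. vec_grad \<Omega> v x = 0" by (rule l2_norm_zero_AE[OF vec_grad_L2[OF H1]])
    then have "AE x in M. ?\<gamma> 1 x * (?\<gamma> 2 x * ?\<beta> 3 x) = 0"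
      using grads(1) by eventually_elim (simp only: flip: grad1, simp)
    then have AE0: "AE x in lebesgue. x \<in> \<Omega> \<longrightarrow> ?\<gamma> 1 x * (?\<gamma> 2 x * ?\<beta> 3 x) = 0"
      by (simp add: AE_restrict_space_iff[OF domain_sets])
    \<comment> \<open>the part of the box on which all three bumps increase\<close>
    let ?Q = "box l ((1/2) *\<^sub>R (l + r))"
    have lr': "l $ i < r $ i" for i using lr(1) by (auto simp: mem_box_cart intro: less_trans)
    have Q: "l $ i < x $ i \<and> x $ i < (l $ i + r $ i) / 2" if "x \<in> ?Q" for x i
      using that by (simp add: mem_box_cart)
    have pos: "?\<gamma> 1 x * (?\<gamma> 2 x * ?\<beta> 3 x) > 0" "x \<in> \<Omega>" if x: "x \<in> ?Q" for x
    proof -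
      have "x $ i < r $ i" for i using Q[OF x, of i] lr'[of i] by (simp add: field_simps)
      then show "?\<gamma> 1 x * (?\<gamma> 2 x * ?\<beta> 3 x) > 0"
        using Q[OF x] by (intro mult_pos_pos bump_deriv_pos bump_pos) auto
      have "x \<in> box l r" using Q[OF x] \<open>\<And>i. x $ i < r $ i\<close> by (simp add: mem_box_cart)
      then show "x \<in> \<Omega>" using lr(2) box_subset_cbox by blast
    qed
    have "AE x in lebesgue. x \<notin> ?Q"
      using AE0 by eventually_elim (use pos in force)
    then have "?Q \<in> null_sets lebesgue"
      by (subst completion.null_sets_iff_AE) (auto simp: fmeasurableD)
    then have "negligible ?Q" by (simp add: negligible_iff_null_sets)
    moreover have "(1/4) *\<^sub>R (3 *\<^sub>R l + r) \<in> ?Q"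
      using lr' by (simp add: mem_box_cart field_simps)
    ultimately show False using open_not_negligible[OF open_box, of l "(1/2) *\<^sub>R (l + r)"] by blast
  qed
  then have "l2_norm \<Omega> (vec_grad \<Omega> v) > 0" using l2_norm_nonneg[of "vec_grad \<Omega> v"] by linarith
  with v show thesis by (rule that)
qed

end

section \<open>The hypercircle estimate\<close>

text \<open>With \<open>w = a + b\<close>, the first bound follows from \<open>\<parallel>w\<parallel>\<^sup>2 = (a, w) + (b, w)\<close> after division by \<open>\<parallel>w\<parallel>\<close>.
  For the second, \<open>\<parallel>b\<parallel>\<^sup>2 = \<parallel>w\<parallel>\<^sup>2 - 2 (a, w) + \<parallel>a\<parallel>\<^sup>2\<close> gives
  \<open>\<parallel>a\<parallel>\<^sup>2 \<le> \<parallel>b\<parallel>\<^sup>2 + E\<^sup>2 - (\<parallel>w\<parallel> - E)\<^sup>2\<close>, which is even slightly stronger than the claim.\<close>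

lemma (in finite_domain) hypercircle_bounds:
  assumes "a \<in> L2 \<Omega>" "b \<in> L2 \<Omega>"
    and E: "l2_inner \<Omega> a (\<lambda>x. a x + b x) \<le> E * l2_norm \<Omega> (\<lambda>x. a x + b x)" "E \<ge> 0"
  shows "l2_norm \<Omega> (\<lambda>x. a x + b x) \<le> l2_norm \<Omega> b + E" "l2_norm \<Omega> a \<le> l2_norm \<Omega> b + E"
proof -
  let ?w = "\<lambda>x. a x + b x"
  have w: "?w \<in> L2 \<Omega>" using assms(1,2) by (rule L2_add)
  have "(l2_norm \<Omega> ?w)\<^sup>2 = l2_inner \<Omega> a ?w + l2_inner \<Omega> b ?w"
    using l2_inner_add_left[OF assms(1,2) w] by (simp add: l2_norm_squared)
  also have "\<dots> \<le> E * l2_norm \<Omega> ?w + l2_norm \<Omega> b * l2_norm \<Omega> ?w"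
    using E(1) l2_Cauchy_Schwarz[OF assms(2) w] by linarith
  finally have "l2_norm \<Omega> ?w * l2_norm \<Omega> ?w \<le> (l2_norm \<Omega> b + E) * l2_norm \<Omega> ?w"
    by (simp add: power2_eq_square algebra_simps)
  then show "l2_norm \<Omega> ?w \<le> l2_norm \<Omega> b + E"
    using l2_norm_nonneg[of ?w] l2_norm_nonneg[of b] E(2)
    by (cases "l2_norm \<Omega> ?w = 0") (auto simp: mult_le_cancel_right)
  show "l2_norm \<Omega> a \<le> l2_norm \<Omega> b + E"
  proof (rule power2_le_imp_le)
    have "(l2_norm \<Omega> b)\<^sup>2 = (l2_norm \<Omega> ?w)\<^sup>2 - 2 * l2_inner \<Omega> a ?w + (l2_norm \<Omega> a)\<^sup>2"
      using l2_norm_diff_squared[OF w assms(1)] by (simp add: l2_inner_commute)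
    then have "(l2_norm \<Omega> a)\<^sup>2 \<le> (l2_norm \<Omega> b)\<^sup>2 + 2 * (E * l2_norm \<Omega> ?w) - (l2_norm \<Omega> ?w)\<^sup>2"
      using E(1) by linarith
    also have "\<dots> = (l2_norm \<Omega> b)\<^sup>2 + E\<^sup>2 - (l2_norm \<Omega> ?w - E)\<^sup>2"
      by (simp add: power2_diff algebra_simps)
    also have "\<dots> \<le> (l2_norm \<Omega> b)\<^sup>2 + E\<^sup>2 + 2 * (l2_norm \<Omega> b * E)"
      using mult_nonneg_nonneg[OF l2_norm_nonneg[of b] E(2)] zero_le_power2[of "l2_norm \<Omega> ?w - E"]
      by linarith
    finally show "(l2_norm \<Omega> a)\<^sup>2 \<le> (l2_norm \<Omega> b + E)\<^sup>2" by (simp add: power2_sum)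
  qed (simp add: l2_norm_nonneg E(2))
qed

text \<open>The residual of \<open>p\<close>, which a priori is a functional of \<open>\<nabla>v\<close>, is represented by the data oscillation
  \<open>f - g\<close> alone: the gradient \<open>\<nabla>\<phi>\<close> in the equilibrium condition is invisible to solenoidal test
  fields. The condition also shows that \<open>g\<close> is square-integrable.\<close>

lemma (in open_domain) equilibrated_residual:
  assumes v: "v \<in> divfree_H10 \<Omega>" and G: "G \<in> L2 \<Omega>" and f: "f \<in> L2 \<Omega>"
    and stokes: "l2_inner \<Omega> G (vec_grad \<Omega> v) = l2_inner \<Omega> f v"
    and p: "\<And>i. (\<lambda>x. p x $ i) \<in> Hdiv \<Omega>" and \<phi>: "\<phi> \<in> H1 \<Omega>"
    and eq: "AE x in M. row_div \<Omega> p x + wgrad \<Omega> \<phi> x + g x = 0"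
  shows "g \<in> L2 \<Omega>" "l2_inner \<Omega> (\<lambda>x. G x - p x) (vec_grad \<Omega> v) = l2_inner \<Omega> (\<lambda>x. f x - g x) v"
proof -
  have p_L2: "p \<in> L2 \<Omega>" unfolding L2_componentwise[where f = p] using p Hdiv_L2 by blast
  note v_L2 = divfree_L2[OF v] and dp = row_div_L2[OF p] and g\<phi> = wgrad_L2[OF \<phi>]
  have sum_L2: "(\<lambda>x. row_div \<Omega> p x + wgrad \<Omega> \<phi> x) \<in> L2 \<Omega>" using dp g\<phi> by (rule L2_add)
  have eq': "AE x in M. - (row_div \<Omega> p x + wgrad \<Omega> \<phi> x) = g x"
    using eq by eventually_elim (rule minus_unique)
  show g: "g \<in> L2 \<Omega>" by (rule L2_AE_cong[OF L2_uminus[OF sum_L2] eq'])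
  have "l2_inner \<Omega> g v = l2_inner \<Omega> (\<lambda>x. - (row_div \<Omega> p x + wgrad \<Omega> \<phi> x)) v"
    by (rule l2_inner_AE_cong[symmetric, OF L2_uminus[OF sum_L2] v_L2 eq']) simp
  also have "\<dots> = - (l2_inner \<Omega> (row_div \<Omega> p) v + l2_inner \<Omega> (wgrad \<Omega> \<phi>) v)"
    using l2_inner_scaleR_left[of "-1" "\<lambda>x. row_div \<Omega> p x + wgrad \<Omega> \<phi> x" v]
    by (simp add: l2_inner_add_left[OF dp g\<phi> v_L2])
  also have "\<dots> = l2_inner \<Omega> p (vec_grad \<Omega> v)"
    using tensor_Green[of v p, OF divfree_components[OF v] p] divfree_orthogonal_gradient[OF v \<phi>] by simp
  finally show "l2_inner \<Omega> (\<lambda>x. G x - p x) (vec_grad \<Omega> v) = l2_inner \<Omega> (\<lambda>x. f x - g x) v"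
    using stokes l2_inner_diff_left[OF G p_L2 vec_grad_L2[OF divfree_H1[OF v]]]
      l2_inner_diff_left[OF f g v_L2] by simp
qed

lemma V_h_subset_divfree: "V_h \<Omega> \<T> k \<subseteq> divfree_H10 \<Omega>"
  by (auto simp: V_h_def divfree_H10_def U_h0_def)

theorem theorem1:
  fixes \<Omega> :: "(real^3) set" and \<T> :: "(real^3) set set"
    and k d m :: nat and C\<^sub>0\<^sub>h :: real
    and f u u\<^sub>h f\<^sub>h :: "real^3 \<Rightarrow> real^3" and p\<^sub>h :: "real^3 \<Rightarrow> real^3^3"
  assumes domain: "lipschitz_polyhedral_domain \<Omega>"
    and mesh: "tetrahedral_mesh \<Omega> \<T>"
    and degrees: "k \<ge> 3" "d = k - 1" "m = k - 1"
    and C0h: "\<And>w w\<^sub>h. \<lbrakk>w \<in> divfree_H10 \<Omega>; is_pi_h \<Omega> \<T> d w w\<^sub>h\<rbrakk> \<Longrightarrow>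
                l2_norm \<Omega> (\<lambda>x. w x - w\<^sub>h x) \<le> C\<^sub>0\<^sub>h * l2_norm \<Omega> (vec_grad \<Omega> w)"
    and f: "f \<in> L2 \<Omega>"
    and u: "u \<in> divfree_H10 \<Omega>"
    and stokes: "\<And>v. v \<in> divfree_H10 \<Omega> \<Longrightarrow>
                   l2_inner \<Omega> (vec_grad \<Omega> u) (vec_grad \<Omega> v) = l2_inner \<Omega> f v"
    and uh: "is_P_h \<Omega> \<T> k u u\<^sub>h"
    and fh: "is_pi_h \<Omega> \<T> d f f\<^sub>h"
    and ph: "p\<^sub>h \<in> tensor_RT_h \<Omega> \<T> m"
    and equilibrium: "\<exists>\<phi>\<^sub>h\<in>U_h \<Omega> \<T> k.
          AE x in lebesgue_on \<Omega>. row_div \<Omega> p\<^sub>h x + wgrad \<Omega> \<phi>\<^sub>h x + f\<^sub>h x = 0"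
  shows "l2_norm \<Omega> (vec_grad \<Omega> (\<lambda>x. u x - u\<^sub>h x))
           \<le> l2_norm \<Omega> (\<lambda>x. p\<^sub>h x - vec_grad \<Omega> u\<^sub>h x) + C\<^sub>0\<^sub>h * l2_norm \<Omega> (\<lambda>x. f x - f\<^sub>h x)
         \<and> l2_norm \<Omega> (\<lambda>x. vec_grad \<Omega> u x - p\<^sub>h x)
           \<le> l2_norm \<Omega> (\<lambda>x. p\<^sub>h x - vec_grad \<Omega> u\<^sub>h x) + C\<^sub>0\<^sub>h * l2_norm \<Omega> (\<lambda>x. f x - f\<^sub>h x)"
proof -
  have dom: "open \<Omega>" "bounded \<Omega>" "\<Omega> \<noteq> {}"
    using domain by (simp_all add: lipschitz_polyhedral_domain_def)
  interpret meshed_domain \<Omega> \<T>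
    using dom mesh by unfold_locales (simp_all add: lmeasurable_open)
  obtain v\<^sub>0 where v\<^sub>0: "v\<^sub>0 \<in> divfree_H10 \<Omega>" "l2_norm \<Omega> (vec_grad \<Omega> v\<^sub>0) > 0"
    using divfree_field_nonzero_gradient[OF dom(3)] .
  \<comment> \<open>A negative \<open>C\<^sub>0\<^sub>h\<close> would bound a norm for \<open>v\<^sub>0\<close> by a negative number.\<close>
  obtain w\<^sub>0 where "is_pi_h \<Omega> \<T> d v\<^sub>0 w\<^sub>0" using pi_h_exists[OF divfree_L2[OF v\<^sub>0(1)]] .
  from order_trans[OF l2_norm_nonneg C0h[OF v\<^sub>0(1) this]] v\<^sub>0(2) have C: "C\<^sub>0\<^sub>h \<ge> 0"
    by (simp add: zero_le_mult_iff)
  have u\<^sub>h: "u\<^sub>h \<in> divfree_H10 \<Omega>" using uh V_h_subset_divfree by (auto simp: is_P_h_def)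
  let ?e = "\<lambda>x. u x - u\<^sub>h x"
  have e: "?e \<in> divfree_H10 \<Omega>" using u u\<^sub>h by (rule divfree_diff)
  have ph': "(\<lambda>x. p\<^sub>h x $ i) \<in> Hdiv \<Omega>" for i using ph by (simp add: tensor_RT_h_def RT_h_def)
  then have ph_L2: "p\<^sub>h \<in> L2 \<Omega>"
    unfolding L2_componentwise[where f = p\<^sub>h] using Hdiv_L2 by blast
  obtain \<phi>\<^sub>h where \<phi>\<^sub>h: "\<phi>\<^sub>h \<in> H1 \<Omega>" "AE x in M. row_div \<Omega> p\<^sub>h x + wgrad \<Omega> \<phi>\<^sub>h x + f\<^sub>h x = 0"
    using equilibrium by (auto simp: U_h_def)
  note grads = vec_grad_L2[OF divfree_H1[OF u]] vec_grad_L2[OF divfree_H1[OF u\<^sub>h]]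
    vec_grad_L2[OF divfree_H1[OF e]]
  note residual = equilibrated_residual[OF e grads(1) f stokes[OF e] ph' \<phi>\<^sub>h]
  obtain e\<^sub>h where e\<^sub>h: "is_pi_h \<Omega> \<T> d ?e e\<^sub>h" using pi_h_exists[OF divfree_L2[OF e]] .
  then have e\<^sub>h_X: "e\<^sub>h \<in> vec_X_h \<T> d" by (simp add: is_pi_h_def)
  note e_L2 = divfree_L2[OF e] and e\<^sub>h_L2 = vec_X_h_L2[OF e\<^sub>h_X]
  let ?r = "\<lambda>x. f x - f\<^sub>h x"
  have r: "?r \<in> L2 \<Omega>" using f residual(1) by (rule L2_diff)
  \<comment> \<open>Subtracting the projection of the error is free, since \<open>f - f\<^sub>h\<close> is orthogonal to it.\<close>
  have "l2_inner \<Omega> ?r e\<^sub>h = 0" using fh e\<^sub>h_X by (simp add: is_pi_h_def)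
  then have "l2_inner \<Omega> ?r ?e = l2_inner \<Omega> ?r (\<lambda>x. ?e x - e\<^sub>h x)"
    using l2_inner_diff_right[OF e_L2 e\<^sub>h_L2 r] by simp
  also have "\<dots> \<le> l2_norm \<Omega> ?r * l2_norm \<Omega> (\<lambda>x. ?e x - e\<^sub>h x)"
    using l2_Cauchy_Schwarz[OF r L2_diff[OF e_L2 e\<^sub>h_L2]] by linarith
  also have "\<dots> \<le> l2_norm \<Omega> ?r * (C\<^sub>0\<^sub>h * l2_norm \<Omega> (vec_grad \<Omega> ?e))"
    by (intro mult_left_mono C0h e e\<^sub>h l2_norm_nonneg)
  finally have bound: "l2_inner \<Omega> (\<lambda>x. vec_grad \<Omega> u x - p\<^sub>h x) (vec_grad \<Omega> ?e)
      \<le> (C\<^sub>0\<^sub>h * l2_norm \<Omega> ?r) * l2_norm \<Omega> (vec_grad \<Omega> ?e)"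
    by (simp add: residual(2) mult_ac)
  let ?a = "\<lambda>x. vec_grad \<Omega> u x - p\<^sub>h x" and ?b = "\<lambda>x. p\<^sub>h x - vec_grad \<Omega> u\<^sub>h x"
  have ab: "?a \<in> L2 \<Omega>" "?b \<in> L2 \<Omega>" using grads ph_L2 by (simp_all add: L2_diff)
  have split: "AE x in M. vec_grad \<Omega> ?e x = ?a x + ?b x"
    using vec_grad_diff[OF divfree_H1[OF u] divfree_H1[OF u\<^sub>h]] by simp
  have norm_e: "l2_norm \<Omega> (vec_grad \<Omega> ?e) = l2_norm \<Omega> (\<lambda>x. ?a x + ?b x)"
    by (rule l2_norm_AE_cong[OF grads(3) split])
  have "l2_inner \<Omega> ?a (vec_grad \<Omega> ?e) = l2_inner \<Omega> ?a (\<lambda>x. ?a x + ?b x)"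
    by (rule l2_inner_AE_cong[OF ab(1) grads(3) _ split]) simp
  with bound have "l2_inner \<Omega> ?a (\<lambda>x. ?a x + ?b x)
      \<le> (C\<^sub>0\<^sub>h * l2_norm \<Omega> ?r) * l2_norm \<Omega> (\<lambda>x. ?a x + ?b x)"
    by (simp only: norm_e)
  from hypercircle_bounds[OF ab this mult_nonneg_nonneg[OF C l2_norm_nonneg]]
  show ?thesis by (simp only: norm_e)
qed

end
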